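(* Let $1 \le p < \infty$, and let $(W_k : k\in\mathbb{N})$ denote one of the following three sequences of spaces: $(H_k^p : k\in\mathbb{N})$, $((H_k^p)^* : k\in\mathbb{N})$, $(SL_k^\infty : k\in\mathbb{N})$. Let $n\in\mathbb{N}$ and let $\delta,\Gamma,\eta>0$ be real numbers. Define the integer $N=N(n,\delta,\Gamma,\eta)$ by $$N = 19(n+2) + \bigl\lfloor 4\log_2(\Gamma/\delta) + 4\log_2(1+\eta^{-1})\bigr\rfloor ,$$ where it is understood that $N\in\mathbb{N}$, so that $W_N$ is defined. Then for any linear operator $T : W_N\to W_N$ satisfying $$\|T\|\le \Gamma \qquad\text{and}\qquad |\langle T h_K, h_K\rangle| \ge \delta |K| \quad\text{for all } K\in\mathcal{D}_{\le N},$$ there exist bounded linear operators $E : W_n\to W_N$ and $F : W_N\to W_n$ such that $$F\,T\,E = \mathrm{Id}_{W_n} \qquad\text{and}\qquad \|E\|\,\|F\| \le \frac{1+\eta}{\delta}.$$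
   Context: All spaces are over $\mathbb{R}$; $\mathbb{N}=\{1,2,\dots\}$, $\mathbb{N}_0=\mathbb{N}\cup\{0\}$; $|\cdot|$ is Lebesgue measure; $\|T\|$ is the operator norm. Dyadic intervals: $\mathcal{D}=\{[(k-1)2^{-m},k2^{-m}) : m\in\mathbb{N}_0,\ 1\le k\le 2^m\}$, $\mathcal{D}_m=\{I\in\mathcal{D}:|I|=2^{-m}\}$, $\mathcal{D}_{\le m}=\bigcup_{j=0}^m\mathcal{D}_j$. Haar system ($L^\infty$-normalized): for $I\in\mathcal{D}$, let $I^+$ and $I^-$ be the left and right halves of $I$ respectively (dyadic intervals with $I^+\cup I^-=I$, $\inf I^+<\inf I^-$), and $h_I=\chi_{I^+}-\chi_{I^-}$. Hardy space: for $1\le p<\infty$ and $k\in\mathbb{N}_0$, $H_k^p$ is $\mathrm{span}\{h_I : I\in\mathcal{D}_{\le k}\}$ with the norm $$\Big\|\sum_I a_I h_I\Big\|_{H^p}=\Big(\int_0^1\Big(\sum_I a_I^2h_I^2(x)\Big)^{p/2}\,dx\Big)^{1/p}.$$ The space $SL_k^\infty$ is $\mathrm{span}\{h_I : I\in\mathcal{D}_{\le k}\}$ with the norm $$\Big\|\sum_I a_Ih_I\Big\|_{SL^\infty}=\Big\|\Big(\sum_I a_I^2h_I^2\Big)^{1/2}\Big\|_{L^\infty}.$$ Pairing: $\langle f,g\rangle=\int_0^1 f(x)g(x)\,dx$. The dual space $(H_k^p)^*$ is identified via this pairing with $\mathrm{span}\{h_I : I\in\mathcal{D}_{\le k}\}$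 equipped with the dual norm $\|f\|_{(H_k^p)^*}=\sup\{|\langle f,g\rangle| : g\in H_k^p,\ \|g\|_{H^p}\le 1\}$. Thus in all three cases $W_k$ is, as a vector space, $\mathrm{span}\{h_I:I\in\mathcal{D}_{\le k}\}$, and $\langle Th_K,h_K\rangle$ is this integral pairing. *)

theory Defs
  imports "HOL-Probability.Essential_Supremum"
begin

definition dyadic :: "real set set" where
  "dyadic = {I. \<exists>(m::nat) (k::nat). 1 \<le> k \<and> k \<le> 2 ^ m \<and>
                  I = {(real k - 1) / 2 ^ m ..< real k / 2 ^ m}}"

definition dyadic_level :: "nat \<Rightarrow> real set set" where
  "dyadic_level m = {I \<in> dyadic. measure lebesgue I = 1 / 2 ^ m}"

definition dyadic_upto :: "nat \<Rightarrow> real set set" where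
  "dyadic_upto m = (\<Union>j\<le>m. dyadic_level j)"

definition left_half :: "real set \<Rightarrow> real set" where
  "left_half I = {Inf I ..< (Inf I + Sup I) / 2}"

definition right_half :: "real set \<Rightarrow> real set" where
  "right_half I = {(Inf I + Sup I) / 2 ..< Sup I}"

definition haar :: "real set \<Rightarrow> real \<Rightarrow> real" where
  "haar I x = indicator (left_half I) x - indicator (right_half I) x"

text \<open>The common underlying vector space of the spaces at level \<open>k\<close>; its elements are genuine
  functions on the real line, vanishing off $[0,1)$.\<close>

definition haar_span :: "nat \<Rightarrow> (real \<Rightarrow> real) set" where
  "haar_span k = {f. \<exists>a :: real set \<Rightarrow> real. f = (\<lambda>x. \<Sum>I\<in>dyadic_upto k. a I * haar I x)}"

text \<open>The unique finitely supported family \<open>a\<close> with $f = \sum_I a_I h_I$; see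
  \<open>haar_coeffs_sum\<close> below.\<close>

definition haar_coeffs :: "(real \<Rightarrow> real) \<Rightarrow> real set \<Rightarrow> real" where
  "haar_coeffs f = (THE a. finite {I. a I \<noteq> 0} \<and> {I. a I \<noteq> 0} \<subseteq> dyadic \<and>
                           f = (\<lambda>x. \<Sum>I | a I \<noteq> 0. a I * haar I x))"

definition sq_sum :: "(real \<Rightarrow> real) \<Rightarrow> real \<Rightarrow> real" where
  "sq_sum f x = (\<Sum>I | haar_coeffs f I \<noteq> 0. (haar_coeffs f I)\<^sup>2 * (haar I x)\<^sup>2)"

definition hardy_norm :: "real \<Rightarrow> (real \<Rightarrow> real) \<Rightarrow> real" where
  "hardy_norm p f = (LINT x:{0..1}|lebesgue. sq_sum f x powr (p / 2)) powr (1 / p)"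

definition sl_norm :: "(real \<Rightarrow> real) \<Rightarrow> real" where
  "sl_norm f = real_of_ereal (esssup (lebesgue_on {0..1}) (\<lambda>x. ereal (sqrt (sq_sum f x))))"

definition pairing :: "(real \<Rightarrow> real) \<Rightarrow> (real \<Rightarrow> real) \<Rightarrow> real" where
  "pairing f g = (LINT x:{0..1}|lebesgue. f x * g x)"

definition hardy_dual_norm :: "real \<Rightarrow> nat \<Rightarrow> (real \<Rightarrow> real) \<Rightarrow> real" where
  "hardy_dual_norm p k f = (SUP g\<in>{g \<in> haar_span k. hardy_norm p g \<le> 1}. \<bar>pairing f g\<bar>)"

text \<open>Operators are total HOL functions; only their values on the domain space matter.
  In the operator norm (as in the dual norm above) the supremum of reals is that of a
  set which is bounded above, because all the spaces involved are finite-dimensional.\<close>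

definition linear_between ::
  "(real \<Rightarrow> real) set \<Rightarrow> (real \<Rightarrow> real) set \<Rightarrow> ((real \<Rightarrow> real) \<Rightarrow> (real \<Rightarrow> real)) \<Rightarrow> bool" where
  "linear_between V W T \<longleftrightarrow>
     (\<forall>f\<in>V. T f \<in> W) \<and>
     (\<forall>f\<in>V. \<forall>g\<in>V. T (\<lambda>x. f x + g x) = (\<lambda>x. T f x + T g x)) \<and>
     (\<forall>c. \<forall>f\<in>V. T (\<lambda>x. c * f x) = (\<lambda>x. c * T f x))"

definition bounded_linear_between ::
  "(real \<Rightarrow> real) set \<Rightarrow> ((real \<Rightarrow> real) \<Rightarrow> real) \<Rightarrow> (real \<Rightarrow> real) set \<Rightarrow> ((real \<Rightarrow> real) \<Rightarrow> real) \<Rightarrow>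
     ((real \<Rightarrow> real) \<Rightarrow> (real \<Rightarrow> real)) \<Rightarrow> bool" where
  "bounded_linear_between V normV W normW T \<longleftrightarrow>
     linear_between V W T \<and> (\<exists>C. \<forall>f\<in>V. normW (T f) \<le> C * normV f)"

definition op_norm ::
  "(real \<Rightarrow> real) set \<Rightarrow> ((real \<Rightarrow> real) \<Rightarrow> real) \<Rightarrow> ((real \<Rightarrow> real) \<Rightarrow> real) \<Rightarrow>
     ((real \<Rightarrow> real) \<Rightarrow> (real \<Rightarrow> real)) \<Rightarrow> real" where
  "op_norm V normV normW T = (SUP f\<in>{f \<in> V. normV f \<le> 1}. normW (T f))"


lemma haar_interval:
  "haar {(real k - 1) / 2 ^ m ..< real k / 2 ^ m} x =
     (if \<lfloor>2 ^ m * x\<rfloor> = int k - 1 then if even \<lfloor>2 ^ Suc m * x\<rfloor> then 1 else -1 else 0)"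
proof -
  define y where "y = 2 ^ m * x"
  have ne: "(real k - 1) / 2 ^ m < real k / 2 ^ m"
    by (simp add: divide_strict_right_mono)
  have mid: "((real k - 1) / 2 ^ m + real k / 2 ^ m) / 2 = (real k - 1 / 2) / 2 ^ m"
    by (simp add: field_simps)
  have x: "x = y / 2 ^ m" by (simp add: y_def)
  have *: "haar {(real k - 1) / 2 ^ m ..< real k / 2 ^ m} x =
     indicator {real k - 1 ..< real k - 1 / 2} y - indicator {real k - 1 / 2 ..< real k} y"
    unfolding haar_def left_half_def right_half_def cInf_atLeastLessThan[OF ne]
      cSup_atLeastLessThan[OF ne] mid
    by (simp add: indicator_def x divide_le_cancel divide_less_cancel)
  have e: "2 ^ Suc m * x = 2 * y" by (simp add: y_def)
  show ?thesis
  proof (cases "\<lfloor>y\<rfloor> = int k - 1")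
    case False
    then have "\<not> (real k - 1 \<le> y \<and> y < real k)"
      by (auto simp: floor_eq_iff)
    then show ?thesis using False unfolding * y_def[symmetric]
      by (auto simp: indicator_def)
  next
    case True
    then have b: "real k - 1 \<le> y" "y < real k" by (auto simp: floor_eq_iff)
    show ?thesis
    proof (cases "y < real k - 1 / 2")
      case le: True
      have "\<lfloor>2 * y\<rfloor> = 2 * (int k - 1)" using b le by (intro floor_unique) auto
      then show ?thesis using True b le unfolding * e y_def[symmetric]
        by (auto simp: indicator_def)
    next
      case ge: False
      have "\<lfloor>2 * y\<rfloor> = 2 * (int k - 1) + 1" using b ge by (intro floor_unique) auto
      then show ?thesis using True b ge unfolding * e y_def[symmetric]
        by (auto simp: indicator_def)
    qed
  qed
qed

lemma floor_pow2_div: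
  assumes "j \<le> m"
  shows "\<lfloor>2 ^ j * (x::real)\<rfloor> = \<lfloor>2 ^ m * x\<rfloor> div 2 ^ (m - j)"
proof -
  have "2 ^ m = 2 ^ j * (2::real) ^ (m - j)"
    using assms by (simp flip: power_add)
  then have "2 ^ j * x = (2 ^ m * x) / real_of_int (2 ^ (m - j))" by simp
  then show ?thesis
    using floor_divide_real_eq_div[of "2 ^ (m - j)" "2 ^ m * x"] by simp
qed

lemma haar_independent:
  assumes S: "finite S" "S \<subseteq> dyadic"
    and z: "\<And>x. (\<Sum>I\<in>S. c I * haar I x) = 0"
    and I: "I \<in> S"
  shows "c I = 0"
proof (rule ccontr)
  assume cI: "c I \<noteq> 0"
  define S' where "S' = {I\<in>S. c I \<noteq> 0}"
  have fin: "finite S'" and ne: "S' \<noteq> {}" using S I cI by (auto simp: S'_def)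
  obtain J where J: "J \<in> S'" and min: "\<And>K. K \<in> S' \<Longrightarrow> Sup J - Inf J \<le> Sup K - Inf K"
    using ex_min_if_finite[of "(\<lambda>K. Sup K - Inf K) ` S'"] fin ne
    by (metis (no_types, lifting) finite_imageI image_iff image_is_empty not_le imageI)
  have len: "Sup {(real k - 1) / 2 ^ m ..< real k / 2 ^ m}
      - Inf {(real k - 1) / 2 ^ m ..< real k / 2 ^ m} = 1 / 2 ^ m" for k m :: nat
  proof -
    have "(real k - 1) / 2 ^ m < real k / 2 ^ m" by (simp add: divide_strict_right_mono)
    then show ?thesis by (simp add: diff_divide_distrib)
  qed
  from J S obtain m k where Jmk: "J = {(real k - 1) / 2 ^ m ..< real k / 2 ^ m}"
    unfolding S'_def dyadic_def by blast
  define x y where "x = (real k - 1) / 2 ^ m" and "y = (real k - 1 / 2) / 2 ^ m"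
  have fx: "\<lfloor>2 ^ m * x\<rfloor> = int k - 1" and fx': "\<lfloor>2 ^ Suc m * x\<rfloor> = 2 * (int k - 1)"
    and fy: "\<lfloor>2 ^ m * y\<rfloor> = int k - 1" and fy': "\<lfloor>2 ^ Suc m * y\<rfloor> = 2 * (int k - 1) + 1"
    by (intro floor_unique; simp add: x_def y_def)+
  have same: "haar K x = haar K y" if K: "K \<in> S'" "K \<noteq> J" for K
  proof -
    from K S obtain l j where Kjl: "K = {(real l - 1) / 2 ^ j ..< real l / 2 ^ j}"
      unfolding S'_def dyadic_def by blast
    have "(1::real) / 2 ^ m \<le> 1 / 2 ^ j" using min[OF K(1)] unfolding Jmk Kjl len .
    then have "(2::real) ^ j \<le> 2 ^ m" by (simp add: field_simps)
    then have jm: "j \<le> m" by simp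
    show ?thesis
    proof (cases "j = m")
      case True
      then have "l \<noteq> k" using K Jmk Kjl by auto
      then show ?thesis unfolding Kjl haar_interval True fx fy by simp
    next
      case False
      then have "Suc j \<le> m" using jm by simp
      then show ?thesis
        unfolding Kjl haar_interval floor_pow2_div[OF jm] floor_pow2_div[OF \<open>Suc j \<le> m\<close>] fx fy
        by simp
    qed
  qed
  have eq: "(\<Sum>I\<in>S. c I * haar I t) = c J * haar J t + (\<Sum>I\<in>S' - {J}. c I * haar I t)" for t
  proof -
    have "(\<Sum>I\<in>S. c I * haar I t) = (\<Sum>I\<in>S'. c I * haar I t)"
      using S by (intro sum.mono_neutral_right) (auto simp: S'_def)
    then show ?thesis using sum.remove[OF fin J] by metis
  qed
  have "(\<Sum>I\<in>S' - {J}. c I * haar I x) = (\<Sum>I\<in>S' - {J}. c I * haar I y)"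
    by (intro sum.cong refl) (simp add: same)
  then have "c J * haar J x = c J * haar J y"
    using z[of x] z[of y] unfolding eq by linarith
  moreover have "haar J x = 1" "haar J y = -1"
    unfolding Jmk haar_interval fx fy fx' fy' by simp_all
  ultimately show False using J by (simp add: S'_def)
qed

lemma haar_coeffs_sum:
  assumes S: "finite S" "S \<subseteq> dyadic" and a: "\<And>I. I \<notin> S \<Longrightarrow> a I = 0"
  shows "haar_coeffs (\<lambda>x. \<Sum>I\<in>S. a I * haar I x) = a"
  unfolding haar_coeffs_def
proof (rule the_equality)
  have sub: "{I. a I \<noteq> 0} \<subseteq> S" using a by auto
  then have "(\<Sum>I\<in>S. a I * haar I x) = (\<Sum>I | a I \<noteq> 0. a I * haar I x)" for x
    using S by (intro sum.mono_neutral_right) auto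
  then show "finite {I. a I \<noteq> 0} \<and> {I. a I \<noteq> 0} \<subseteq> dyadic \<and>
      (\<lambda>x. \<Sum>I\<in>S. a I * haar I x) = (\<lambda>x. \<Sum>I | a I \<noteq> 0. a I * haar I x)"
    using S sub finite_subset by auto
next
  fix b
  assume b: "finite {I. b I \<noteq> 0} \<and> {I. b I \<noteq> 0} \<subseteq> dyadic \<and>
      (\<lambda>x. \<Sum>I\<in>S. a I * haar I x) = (\<lambda>x. \<Sum>I | b I \<noteq> 0. b I * haar I x)"
  define R where "R = S \<union> {I. b I \<noteq> 0}"
  have R: "finite R" "R \<subseteq> dyadic" using S b by (auto simp: R_def)
  have "(\<Sum>I\<in>R. (b I - a I) * haar I x) = 0" for x
  proof -
    have "(\<Sum>I\<in>S. a I * haar I x) = (\<Sum>I\<in>R. a I * haar I x)"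
      using R a by (intro sum.mono_neutral_left) (auto simp: R_def)
    moreover have "(\<Sum>I | b I \<noteq> 0. b I * haar I x) = (\<Sum>I\<in>R. b I * haar I x)"
      using R by (intro sum.mono_neutral_left) (auto simp: R_def)
    moreover have "(\<Sum>I\<in>S. a I * haar I x) = (\<Sum>I | b I \<noteq> 0. b I * haar I x)"
      using b by meson
    ultimately show ?thesis by (simp add: left_diff_distrib sum_subtractf)
  qed
  then have "b I - a I = 0" if "I \<in> R" for I
    using haar_independent[OF R, of "\<lambda>I. b I - a I"] that by blast
  then show "b = a" using a by (force simp: R_def)
qed

lemma dyadic_upto_eq:
  "dyadic_upto k =
     (\<lambda>(m, l). {(real l - 1) / 2 ^ m ..< real l / 2 ^ m}) ` (SIGMA m:{..k}. {1..2 ^ m})"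
proof -
  have [simp]: "measure lebesgue {(real l - 1) / 2 ^ m ..< real l / 2 ^ m} = 1 / 2 ^ m"
    for l m :: nat
  proof -
    have "(real l - 1) / 2 ^ m \<le> real l / 2 ^ m" by (simp add: divide_right_mono)
    then show ?thesis by (simp add: diff_divide_distrib)
  qed
  show ?thesis
    unfolding dyadic_upto_def dyadic_level_def dyadic_def by (fastforce simp: image_iff)
qed

lemma finite_dyadic_upto: "finite (dyadic_upto k)"
  unfolding dyadic_upto_eq by simp

end

theory Submission
  imports Defs
begin

text \<open>Put $m = N - n$. Sending $h_I$ to the signed sum $b_I = \sum_K \varepsilon_K h_K$ over the $2^m$
  copies $K$ of $I$ inside the intervals of level $m$, and averaging back, gives maps of norm at most one
  for each of the three norms and every choice of signs, because these norms only see the absolute values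
  of the Haar coefficients; the supports of the $b_I$ therefore need not be adapted to the signs.
  Testing $T$ on single Haar functions and on signed sums of one level bounds the sum of all
  $\langle T h_K, h_L\rangle^2$, with $K$ and $L$ of level at least $m$, by a multiple of $2^{-m/2}$.
  For independent random signs the second moments of the off-diagonal parts of
  $\langle T b_I, b_J\rangle$ add up to at most twice that, so some choice of signs makes the compressed operator
  a small perturbation of a diagonal operator with entries at least $\delta$, which is inverted by a
  Neumann series.\<close>

section \<open>Dyadic indices and norms of Haar coefficients\<close>

text \<open>Bounding single entries by the operator norm is not enough: squares of size
  \<open>\<Gamma>^2 / 4^m\<close> have to be summed over about \<open>4^(m+n)\<close> pairs of deep
  intervals. The sum of the absolute values of the pairings of T h_K with h_L over two deep levels
  is at most \<open>\<Gamma> 2^(m+n)\<close> times \<open>2^(-m \<theta>)\<close>, by single Haar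
  functions, and also times \<open>2^(-m (1-\<theta>))\<close>, by signed level sums. Which bound is
  the better one depends on the space, but their geometric mean always contains
  \<open>2^(-m/2)\<close>; so one N serves all three sequences. The 4 before the logarithms arises
  because second moments double the exponent of \<open>\<Gamma>/\<delta>\<close> and the square root
  doubles it again. The dependence on n costs 9n + 3 binary digits in the second moment: 2n for the
  pairs of levels, n for their sizes, 1 for the random signs, 2n + 2 for Cauchy-Schwarz over the
  pairs I, J, and 4n for the length weights and the comparison of coefficients with norms. Thus m
  has to be at least 18n + 6 plus the logarithms, and N = m + n turns 18 into 19.\<close>

definition idx :: "nat \<Rightarrow> (nat \<times> nat) set" where
  "idx n = Sigma {..n} (\<lambda>j. {..<2 ^ j})"

lemma finite_idx [simp]: "finite (idx n)"
  by (simp add: idx_def)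

lemma idx_iff [simp]: "(j, r) \<in> idx n \<longleftrightarrow> j \<le> n \<and> r < 2 ^ j"
  by (auto simp: idx_def)

lemma sum_idx: "(\<Sum>K\<in>idx n. f K) = (\<Sum>j\<le>n. \<Sum>r<2^j. f (j, r))"
  unfolding idx_def by (subst sum.Sigma) auto

lemma card_idx: "card (idx n) \<le> 2 ^ Suc n"
proof -
  have "card (idx n) = (\<Sum>j\<le>n. 2 ^ j)" by (simp add: idx_def)
  also have "\<dots> = 2 ^ Suc n - 1" by (induction n) auto
  finally show ?thesis by simp
qed

text \<open>The pair \<open>(j, r)\<close> stands for the dyadic interval from
  \<open>r / 2 ^ j\<close> to \<open>(r + 1) / 2 ^ j\<close>. Positions count from zero, unlike in
  \<open>dyadic\<close>, so that the ancestor l levels up is found by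
  \<open>div 2 ^ l\<close>.\<close>

definition len :: "nat \<times> nat \<Rightarrow> real" where
  "len K = 1 / 2 ^ fst K"

lemma len_pos [simp]: "len K > 0" "len K \<noteq> 0" "\<bar>len K\<bar> = len K"
  by (simp_all add: len_def)

text \<open>Every dyadic interval $K$ of level at least $m$ is a contracted copy, inside an interval
  of level $m$, of the dyadic interval \<open>base m K\<close>; \<open>fibre m I\<close> collects the
  $2^m$ copies of $I$.\<close>

definition base :: "nat \<Rightarrow> nat \<times> nat \<Rightarrow> nat \<times> nat" where
  "base m K = (fst K - m, snd K mod 2 ^ (fst K - m))"

definition copy :: "nat \<Rightarrow> nat \<times> nat \<Rightarrow> nat \<Rightarrow> nat \<times> nat" where
  "copy m I u = (m + fst I, u * 2 ^ fst I + snd I)"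

definition fibre :: "nat \<Rightarrow> nat \<times> nat \<Rightarrow> (nat \<times> nat) set" where
  "fibre m I = copy m I ` {..<2 ^ m}"

text \<open>With all signs equal to 1, \<open>dil m a\<close> is the coefficient family of the sum
  of the a_I b_I. The case distinction keeps the truncated subtraction in \<open>base\<close> away
  from levels coarser than m, which contain no copies.\<close>

definition dil :: "nat \<Rightarrow> (nat \<times> nat \<Rightarrow> real) \<Rightarrow> nat \<times> nat \<Rightarrow> real" where
  "dil m a K = (if m \<le> fst K then a (base m K) else 0)"

definition avg :: "nat \<Rightarrow> (nat \<times> nat \<Rightarrow> real) \<Rightarrow> nat \<times> nat \<Rightarrow> real" where
  "avg m b I = (\<Sum>K\<in>fibre m I. b K) / 2 ^ m"

lemma inj_copy: "inj (copy m I)"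
  by (auto simp: inj_def copy_def)

lemma finite_fibre [simp]: "finite (fibre m I)"
  by (simp add: fibre_def)

lemma card_fibre [simp]: "card (fibre m I) = 2 ^ m"
  unfolding fibre_def by (subst card_image) (auto intro: inj_on_subset[OF inj_copy])

lemma sum_fibre: "(\<Sum>K\<in>fibre m I. f K) = (\<Sum>u<2^m. f (copy m I u))"
  unfolding fibre_def by (subst sum.reindex) (auto intro: inj_on_subset[OF inj_copy])

text \<open>The fibres partition the intervals of levels m to m + n. This lets sums over deep
  intervals be regrouped by base, and separates the fibres of distinct I.\<close>

lemma fibre_eq:
  assumes "I \<in> idx n"
  shows "fibre m I = {K \<in> idx (m + n). m \<le> fst K \<and> base m K = I}"
proof -
  obtain i k where I: "I = (i, k)" by force
  with assms have i: "i \<le> n" "k < 2 ^ i" by auto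
  show ?thesis
  proof (intro set_eqI iffI)
    fix K assume "K \<in> fibre m I"
    then obtain u where u: "u < 2 ^ m" "K = (m + i, u * 2 ^ i + k)"
      by (auto simp: fibre_def copy_def I)
    have "u * 2 ^ i + k < (u + 1) * 2 ^ i" using i by simp
    also have "\<dots> \<le> 2 ^ m * 2 ^ i" using u by (intro mult_right_mono) auto
    finally show "K \<in> {K \<in> idx (m + n). m \<le> fst K \<and> base m K = I}"
      using u i by (auto simp: I base_def power_add)
  next
    fix K assume "K \<in> {K \<in> idx (m + n). m \<le> fst K \<and> base m K = I}"
    moreover obtain l r where K: "K = (l, r)" by force
    ultimately have K': "r < 2 ^ l" "m \<le> l" "i = l - m" "k = r mod 2 ^ i"
      by (auto simp: base_def I)
    \<comment> \<open>Quotient and remainder of the position: \<open>u\<close> numbers the level-m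
      interval containing K, and the remainder is the position of K relative to it.\<close>
    define u where "u = r div 2 ^ i"
    have "r = u * 2 ^ i + k" unfolding u_def K'(4) by (rule div_mult_mod_eq[symmetric])
    moreover have "u < 2 ^ m"
      unfolding u_def using K'
      by (metis le_add_diff_inverse less_mult_imp_div_less power_add)
    ultimately show "K \<in> fibre m I"
      using K' unfolding fibre_def copy_def I K by auto
  qed
qed

lemma fibre_sub: "I \<in> idx n \<Longrightarrow> K \<in> fibre m I \<Longrightarrow> K \<in> idx (m + n) \<and> m \<le> fst K \<and> base m K = I"
  using fibre_eq by auto

lemma base_in_idx: "K \<in> idx (m + n) \<Longrightarrow> base m K \<in> idx n"
  by (cases K) (auto simp: base_def)

lemma len_fibre: "K \<in> fibre m I \<Longrightarrow> len K = len I / 2 ^ m"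
  by (auto simp: fibre_def copy_def len_def power_add)

lemma dil_fibre: "I \<in> idx n \<Longrightarrow> K \<in> fibre m I \<Longrightarrow> dil m a K = a I"
  using fibre_sub[of I n K m] by (simp add: dil_def)

lemma sum_by_fibres:
  assumes "\<And>K. K \<in> idx (m + n) \<Longrightarrow> fst K < m \<Longrightarrow> f K = 0"
  shows "(\<Sum>K\<in>idx (m + n). f K) = (\<Sum>I\<in>idx n. \<Sum>K\<in>fibre m I. f K)"
proof -
  let ?S = "{K \<in> idx (m + n). m \<le> fst K}"
  have "(\<Sum>K\<in>idx (m + n). f K) = (\<Sum>K\<in>?S. f K)"
    using assms by (intro sum.mono_neutral_right) (auto simp: not_le)
  also have "\<dots> = (\<Sum>I\<in>idx n. \<Sum>K\<in>{K. K \<in> ?S \<and> base m K = I}. f K)"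
    using base_in_idx by (intro sum.group[symmetric]) auto
  also have "\<dots> = (\<Sum>I\<in>idx n. \<Sum>K\<in>fibre m I. f K)"
    using fibre_eq by (intro sum.cong) (auto simp: conj_assoc)
  finally show ?thesis .
qed

definition pair :: "nat \<Rightarrow> (nat \<times> nat \<Rightarrow> real) \<Rightarrow> (nat \<times> nat \<Rightarrow> real) \<Rightarrow> real" where
  "pair n a b = (\<Sum>K\<in>idx n. len K * a K * b K)"

lemma pair_commute: "pair n a b = pair n b a"
  by (simp add: pair_def mult_ac)

text \<open>A copy has \<open>2^(-m)\<close> times the length of its base, and this weight turns the
  sum over a fibre into a mean. The adjointness exchanges the axioms \<open>dilate\<close> and
  \<open>average\<close> below when passing to the dual norm.\<close>

lemma pair_dil: "pair (m + n) (dil m a) b = pair n a (avg m b)"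
proof -
  have "pair (m + n) (dil m a) b = (\<Sum>I\<in>idx n. \<Sum>K\<in>fibre m I. len K * dil m a K * b K)"
    unfolding pair_def by (rule sum_by_fibres) (auto simp: dil_def)
  also have "\<dots> = (\<Sum>I\<in>idx n. \<Sum>K\<in>fibre m I. len I * a I * b K / 2 ^ m)"
    by (intro sum.cong) (auto simp: len_fibre dil_fibre)
  also have "\<dots> = pair n a (avg m b)"
    by (simp add: pair_def avg_def sum_distrib_left sum_divide_distrib)
  finally show ?thesis .
qed

text \<open>The three sequences of spaces enter the argument only through the following properties
  of their norms, written in terms of Haar coefficients; $|I|^\theta$ is the norm of $h_I$.\<close>

locale haar_norm =
  fixes \<nu> :: "nat \<Rightarrow> (nat \<times> nat \<Rightarrow> real) \<Rightarrow> real" and \<theta> :: real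
  assumes theta: "0 \<le> \<theta>" "\<theta> \<le> 1"
    and mono: "(\<And>K. K \<in> idx n \<Longrightarrow> \<bar>a K\<bar> \<le> \<bar>b K\<bar>) \<Longrightarrow> \<nu> n a \<le> \<nu> n b"
    and triangle: "\<nu> n (\<lambda>K. a K + b K) \<le> \<nu> n a + \<nu> n b"
    and homog: "\<nu> n (\<lambda>K. c * a K) = \<bar>c\<bar> * \<nu> n a"
    and single: "K \<in> idx n \<Longrightarrow> \<nu> n (\<lambda>L. of_bool (L = K)) = len K powr \<theta>"
    and level_sum: "j \<le> n \<Longrightarrow> (\<Sum>r<2^j. \<bar>a (j, r)\<bar>) / 2 ^ j \<le> \<nu> n a"
    and level_one: "j \<le> n \<Longrightarrow> \<nu> n (\<lambda>K. of_bool (fst K = j)) \<le> 1"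
    and dilate: "\<nu> (m + n) (dil m a) \<le> \<nu> n a"
    and average: "\<nu> n (avg m b) \<le> \<nu> (m + n) b"
begin

lemma zero: "\<nu> n (\<lambda>K. 0) = 0"
  using homog[of n 0 "\<lambda>K. 0"] by simp

lemma nonneg: "0 \<le> \<nu> n a"
  using mono[of n "\<lambda>K. 0" a] zero by simp

lemma cong: "(\<And>K. K \<in> idx n \<Longrightarrow> \<bar>a K\<bar> = \<bar>b K\<bar>) \<Longrightarrow> \<nu> n a = \<nu> n b"
  by (intro antisym mono) auto

lemma triangle_sum: "\<nu> n (\<lambda>K. \<Sum>i\<in>S. f i K) \<le> (\<Sum>i\<in>S. \<nu> n (f i))"
proof (induction S rule: infinite_finite_induct)
  case (insert x F)
  then show ?case using triangle[of n "f x" "\<lambda>K. \<Sum>i\<in>F. f i K"] by simp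
qed (simp_all add: zero)

text \<open>The lattice axiom \<open>mono\<close> allows all coefficients but one to be erased.
  Together with \<open>expand_le\<close> this compares any of the norms with weighted
  coefficients.\<close>

lemma coeff_le:
  assumes "K \<in> idx n"
  shows "\<bar>a K\<bar> * len K powr \<theta> \<le> \<nu> n a"
proof -
  have "\<bar>a K\<bar> * len K powr \<theta> = \<nu> n (\<lambda>L. a K * of_bool (L = K))"
    using assms by (simp only: homog single)
  also have "\<dots> \<le> \<nu> n a" by (intro mono) auto
  finally show ?thesis .
qed

lemma expand_le: "\<nu> n a \<le> (\<Sum>K\<in>idx n. \<bar>a K\<bar> * len K powr \<theta>)"
proof -
  have "\<nu> n a = \<nu> n (\<lambda>L. \<Sum>K\<in>idx n. a K * of_bool (L = K))"
    by (intro cong) simp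
  also have "\<dots> \<le> (\<Sum>K\<in>idx n. \<nu> n (\<lambda>L. a K * of_bool (L = K)))" by (rule triangle_sum)
  also have "\<dots> = (\<Sum>K\<in>idx n. \<bar>a K\<bar> * len K powr \<theta>)"
    by (intro sum.cong refl) (simp only: homog single)
  finally show ?thesis .
qed

end

lemma len_le_1: "len K \<le> 1"
  by (simp add: len_def)

section \<open>Dual norms in coefficient form\<close>

definition dual :: "(nat \<Rightarrow> (nat \<times> nat \<Rightarrow> real) \<Rightarrow> real) \<Rightarrow> nat \<Rightarrow> (nat \<times> nat \<Rightarrow> real) \<Rightarrow> real" where
  "dual \<nu> n a = (SUP b\<in>{b. \<nu> n b \<le> 1}. \<bar>pair n a b\<bar>)"

context haar_norm
begin

text \<open>A real \<open>SUP\<close> carries information only for sets bounded above. Here each of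
  the finitely many coefficients of b is controlled by \<open>coeff_le\<close>.\<close>

lemma dual_bdd: "bdd_above ((\<lambda>b. \<bar>pair n a b\<bar>) ` {b. \<nu> n b \<le> 1})"
proof (intro bdd_aboveI2)
  fix b assume "b \<in> {b. \<nu> n b \<le> 1}"
  then have b: "\<nu> n b \<le> 1" by simp
  have "\<bar>pair n a b\<bar> \<le> (\<Sum>K\<in>idx n. \<bar>len K * a K * b K\<bar>)"
    unfolding pair_def by (rule sum_abs)
  also have "\<dots> \<le> (\<Sum>K\<in>idx n. len K * \<bar>a K\<bar> / len K powr \<theta>)"
  proof (intro sum_mono)
    fix K assume "K \<in> idx n"
    then have "\<bar>b K\<bar> * len K powr \<theta> \<le> 1" using coeff_le[of K n b] b by simp
    then have "\<bar>b K\<bar> \<le> 1 / len K powr \<theta>" by (simp add: field_simps)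
    then have "len K * \<bar>a K\<bar> * \<bar>b K\<bar> \<le> len K * \<bar>a K\<bar> * (1 / len K powr \<theta>)"
      by (intro mult_left_mono) (simp_all add: less_imp_le)
    then show "\<bar>len K * a K * b K\<bar> \<le> len K * \<bar>a K\<bar> / len K powr \<theta>"
      by (simp add: abs_mult less_imp_le)
  qed
  finally show "\<bar>pair n a b\<bar> \<le> (\<Sum>K\<in>idx n. len K * \<bar>a K\<bar> / len K powr \<theta>)" .
qed

lemma dual_upper: "\<nu> n b \<le> 1 \<Longrightarrow> \<bar>pair n a b\<bar> \<le> dual \<nu> n a"
  unfolding dual_def by (intro cSUP_upper dual_bdd) auto

lemma dual_le: "(\<And>b. \<nu> n b \<le> 1 \<Longrightarrow> \<bar>pair n a b\<bar> \<le> c) \<Longrightarrow> dual \<nu> n a \<le> c"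
  unfolding dual_def
  by (intro cSUP_least) (auto intro!: exI[of _ "\<lambda>K. 0"] simp: zero)

text \<open>The axioms are chosen to be self-dual: \<open>level_sum\<close> and
  \<open>level_one\<close> are exchanged, as are \<open>dilate\<close> and \<open>average\<close>,
  and since the pairing of h_I with itself is |I|, the exponent \<theta> turns into 1 - \<theta>.
  Hence the dual Hardy spaces need no separate factorization argument.\<close>

lemma dual_haar_norm: "haar_norm (dual \<nu>) (1 - \<theta>)"
proof
  show "0 \<le> 1 - \<theta>" "1 - \<theta> \<le> 1" using theta by auto
next
  fix n a b assume ab: "\<And>K. K \<in> idx n \<Longrightarrow> \<bar>a K :: real\<bar> \<le> \<bar>b K\<bar>"
  show "dual \<nu> n a \<le> dual \<nu> n b"
  proof (rule dual_le)
    fix g assume g: "\<nu> n g \<le> 1"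
    \<comment> \<open>The signs of b are put on |g|, so that no cancellation is left in the pairing
      with b; by \<open>mono\<close> the new test family is still admissible.\<close>
    define g' where "g' = (\<lambda>K. sgn (b K) * \<bar>g K\<bar>)"
    have "\<nu> n g' \<le> \<nu> n g" by (intro mono) (simp add: g'_def abs_mult sgn_real_def)
    have "\<bar>pair n a g\<bar> \<le> (\<Sum>K\<in>idx n. \<bar>len K * a K * g K\<bar>)"
      unfolding pair_def by (rule sum_abs)
    also have "\<dots> \<le> (\<Sum>K\<in>idx n. len K * b K * g' K)"
    proof (intro sum_mono)
      fix K assume "K \<in> idx n"
      then have "len K * \<bar>a K\<bar> * \<bar>g K\<bar> \<le> len K * \<bar>b K\<bar> * \<bar>g K\<bar>"
        by (intro mult_right_mono mult_left_mono ab) (simp_all add: less_imp_le)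
      moreover have "len K * b K * g' K = len K * \<bar>b K\<bar> * \<bar>g K\<bar>"
        by (simp add: g'_def abs_sgn[of "b K"])
      ultimately show "\<bar>len K * a K * g K\<bar> \<le> len K * b K * g' K"
        by (simp add: abs_mult less_imp_le)
    qed
    also have "\<dots> \<le> \<bar>pair n b g'\<bar>" by (simp add: pair_def)
    also have "\<dots> \<le> dual \<nu> n b" using g \<open>\<nu> n g' \<le> \<nu> n g\<close> by (intro dual_upper) simp
    finally show "\<bar>pair n a g\<bar> \<le> dual \<nu> n b" .
  qed
next
  fix n and a b :: "nat \<times> nat \<Rightarrow> real"
  show "dual \<nu> n (\<lambda>K. a K + b K) \<le> dual \<nu> n a + dual \<nu> n b"
  proof (rule dual_le)
    fix g assume g: "\<nu> n g \<le> 1"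
    have "pair n (\<lambda>K. a K + b K) g = pair n a g + pair n b g"
      by (simp add: pair_def algebra_simps sum.distrib)
    then show "\<bar>pair n (\<lambda>K. a K + b K) g\<bar> \<le> dual \<nu> n a + dual \<nu> n b"
      using dual_upper[OF g, of a] dual_upper[OF g, of b] by linarith
  qed
next
  fix n c and a :: "nat \<times> nat \<Rightarrow> real"
  have eq: "\<bar>pair n (\<lambda>K. c * a K) g\<bar> = \<bar>c\<bar> * \<bar>pair n a g\<bar>" for g c a
    by (simp add: pair_def abs_mult[symmetric] sum_distrib_left mult_ac)
  have le: "dual \<nu> n (\<lambda>K. c * a K) \<le> \<bar>c\<bar> * dual \<nu> n a" for c a
    by (rule dual_le) (auto simp: eq intro!: mult_left_mono dual_upper)
  show "dual \<nu> n (\<lambda>K. c * a K) = \<bar>c\<bar> * dual \<nu> n a"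
  proof (cases "c = 0")
    case True
    have "pair n (\<lambda>K. c * a K) g = 0" for g using True by (simp add: pair_def)
    then have "dual \<nu> n (\<lambda>K. c * a K) = 0"
      using dual_upper[of n "\<lambda>K. 0" "\<lambda>K. c * a K"] zero[of n] dual_le[of n "\<lambda>K. c * a K" 0]
      by simp
    then show ?thesis using True by simp
  next
    case False
    \<comment> \<open>The reverse inequality is the same estimate, applied to the family c a and the
      factor 1/c.\<close>
    have "dual \<nu> n (\<lambda>K. inverse c * (c * a K)) \<le> \<bar>inverse c\<bar> * dual \<nu> n (\<lambda>K. c * a K)"
      by (rule le)
    then have "\<bar>c\<bar> * dual \<nu> n a \<le> dual \<nu> n (\<lambda>K. c * a K)"
      using False by (simp add: field_simps abs_inverse)
    with le[of c a] show ?thesis by simp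
  qed
next
  fix K :: "nat \<times> nat" and n assume K: "K \<in> idx n"
  have p: "pair n (\<lambda>L. of_bool (L = K)) g = len K * g K" for g
    using K by (simp add: pair_def of_bool_def if_distrib if_distribR cong: if_cong)
  have pw: "len K powr (1 - \<theta>) = len K / len K powr \<theta>"
    by (simp add: powr_diff)
  show "dual \<nu> n (\<lambda>L. of_bool (L = K)) = len K powr (1 - \<theta>)"
  proof (rule antisym)
    show "dual \<nu> n (\<lambda>L. of_bool (L = K)) \<le> len K powr (1 - \<theta>)"
    proof (rule dual_le)
      fix g assume "\<nu> n g \<le> 1"
      then have "\<bar>g K\<bar> * len K powr \<theta> \<le> 1" using coeff_le[OF K, of g] by simp
      then show "\<bar>pair n (\<lambda>L. of_bool (L = K)) g\<bar> \<le> len K powr (1 - \<theta>)"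
        unfolding p pw by (simp add: field_simps abs_mult)
    qed
    \<comment> \<open>The normalised Haar function attains the supremum.\<close>
    define g where "g = (\<lambda>L. 1 / len K powr \<theta> * of_bool (L = K) :: real)"
    have "\<nu> n g \<le> 1" unfolding g_def homog single[OF K] by simp
    from dual_upper[OF this, of "\<lambda>L. of_bool (L = K)"]
    show "len K powr (1 - \<theta>) \<le> dual \<nu> n (\<lambda>L. of_bool (L = K))"
      unfolding p pw by (simp add: g_def)
  qed
next
  fix j n :: nat and a :: "nat \<times> nat \<Rightarrow> real" assume j: "j \<le> n"
  \<comment> \<open>Testing against the signed sum of level j, of norm at most 1 by
    \<open>level_one\<close>, recovers the absolute sum of that level.\<close>
  define g where "g = (\<lambda>K. sgn (a K) * of_bool (fst K = j))"
  have "\<nu> n g \<le> \<nu> n (\<lambda>K. of_bool (fst K = j))"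
    by (intro mono) (simp add: g_def abs_mult sgn_real_def)
  then have "\<nu> n g \<le> 1" using level_one[OF j] by simp
  have "pair n a g = (\<Sum>i\<le>n. if i = j then (\<Sum>r<2^i. \<bar>a (i, r)\<bar>) / 2 ^ i else 0)"
    unfolding pair_def sum_idx
    by (intro sum.cong refl) (auto simp: g_def len_def abs_sgn sum_divide_distrib mult_ac)
  also have "\<dots> = (\<Sum>r<2^j. \<bar>a (j, r)\<bar>) / 2 ^ j"
    using j by simp
  finally show "(\<Sum>r<2^j. \<bar>a (j, r)\<bar>) / 2 ^ j \<le> dual \<nu> n a"
    using dual_upper[OF \<open>\<nu> n g \<le> 1\<close>, of a] by linarith
next
  fix j n :: nat assume j: "j \<le> n"
  show "dual \<nu> n (\<lambda>K. of_bool (fst K = j)) \<le> 1"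
  proof (rule dual_le)
    fix g assume g: "\<nu> n g \<le> 1"
    have "pair n (\<lambda>K. of_bool (fst K = j)) g = (\<Sum>i\<le>n. if i = j then (\<Sum>r<2^i. g (i, r)) / 2 ^ i else 0)"
      unfolding pair_def sum_idx
      by (intro sum.cong refl) (auto simp: len_def sum_divide_distrib)
    also have "\<dots> = (\<Sum>r<2^j. g (j, r)) / 2 ^ j"
      using j by simp
    finally have "\<bar>pair n (\<lambda>K. of_bool (fst K = j)) g\<bar> \<le> (\<Sum>r<2^j. \<bar>g (j, r)\<bar>) / 2 ^ j"
      by (simp add: divide_right_mono)
    then show "\<bar>pair n (\<lambda>K. of_bool (fst K = j)) g\<bar> \<le> 1"
      using level_sum[OF j, of g] g by linarith
  qed
next
  fix m n and a :: "nat \<times> nat \<Rightarrow> real"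
  show "dual \<nu> (m + n) (dil m a) \<le> dual \<nu> n a"
  proof (rule dual_le)
    fix g assume "\<nu> (m + n) g \<le> 1"
    then have "\<nu> n (avg m g) \<le> 1" using average[of n m g] by simp
    then show "\<bar>pair (m + n) (dil m a) g\<bar> \<le> dual \<nu> n a"
      unfolding pair_dil by (rule dual_upper)
  qed
  show "dual \<nu> n (avg m a) \<le> dual \<nu> (m + n) a"
  proof (rule dual_le)
    fix g assume "\<nu> n g \<le> 1"
    then have "\<nu> (m + n) (dil m g) \<le> 1" using dilate[of m n g] by simp
    then show "\<bar>pair n (avg m a) g\<bar> \<le> dual \<nu> (m + n) a"
      using pair_dil[of m n g a] dual_upper[of "m + n" "dil m g" a] by (simp add: pair_commute)
  qed
qed

end

section \<open>Random signs and the Neumann series\<close>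

text \<open>A sign pattern is encoded by the set A of indices carrying -1, so the expectation over
  independent signs on S is the sum over \<open>Pow S\<close> divided by
  \<open>2 ^ card S\<close>.\<close>

definition rad :: "'a set \<Rightarrow> 'a \<Rightarrow> real" where
  "rad A x = (if x \<in> A then -1 else 1)"

lemma rad_sq [simp]: "rad A x * rad A x = 1" "\<bar>rad A x\<bar> = 1"
  by (auto simp: rad_def)

lemma sum_Pow_insert:
  assumes "finite S" "x \<notin> S"
  shows "(\<Sum>A\<in>Pow (insert x S). f A) = (\<Sum>A\<in>Pow S. f A + f (insert x A))"
proof -
  have "inj_on (insert x) (Pow S)" using assms(2) by (auto simp: inj_on_def)
  moreover have "Pow S \<inter> insert x ` Pow S = {}" using assms(2) by auto
  ultimately show ?thesis
    using assms by (simp add: Pow_insert sum.union_disjoint sum.reindex sum.distrib)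
qed

lemma rad_insert_same [simp]: "x \<notin> A \<Longrightarrow> rad (insert x A) x = -1" "x \<notin> A \<Longrightarrow> rad A x = 1"
  by (auto simp: rad_def)

lemma sum_rad_insert:
  assumes "x \<notin> S"
  shows "(\<Sum>y\<in>S. rad (insert x A) y * c y) = (\<Sum>y\<in>S. rad A y * c y)"
  using assms by (intro sum.cong) (auto simp: rad_def)

text \<open>Pairing each A with \<open>insert x A\<close> flips one sign, and the sum of the squares
  of u + v and u - v contains no mixed term.\<close>

lemma rademacher_linear:
  assumes "finite S"
  shows "(\<Sum>A\<in>Pow S. (\<Sum>x\<in>S. rad A x * c x)\<^sup>2) = 2 ^ card S * (\<Sum>x\<in>S. (c x)\<^sup>2)"
  using assms
proof (induction S rule: finite_induct)
  case (insert x S)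
  have "(\<Sum>A\<in>Pow (insert x S). (\<Sum>y\<in>insert x S. rad A y * c y)\<^sup>2)
      = (\<Sum>A\<in>Pow S. 2 * (c x)\<^sup>2 + 2 * (\<Sum>y\<in>S. rad A y * c y)\<^sup>2)"
    unfolding sum_Pow_insert[OF insert(1,2)]
  proof (intro sum.cong refl)
    fix A assume "A \<in> Pow S"
    then have "x \<notin> A" using insert by auto
    then have "(\<Sum>y\<in>insert x S. rad A y * c y) = c x + (\<Sum>y\<in>S. rad A y * c y)"
      "(\<Sum>y\<in>insert x S. rad (insert x A) y * c y) = (\<Sum>y\<in>S. rad A y * c y) - c x"
      using insert by (simp_all add: sum_rad_insert)
    then show "(\<Sum>y\<in>insert x S. rad A y * c y)\<^sup>2 + (\<Sum>y\<in>insert x S. rad (insert x A) y * c y)\<^sup>2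
        = 2 * (c x)\<^sup>2 + 2 * (\<Sum>y\<in>S. rad A y * c y)\<^sup>2"
      by (simp add: power2_sum power2_diff)
  qed
  also have "\<dots> = 2 ^ card S * (2 * (c x)\<^sup>2) + 2 * (2 ^ card S * (\<Sum>x\<in>S. (c x)\<^sup>2))"
    using insert by (simp add: sum.distrib sum_distrib_left[symmetric] card_Pow)
  finally show ?case using insert by (simp add: algebra_simps)
qed simp

text \<open>The same sign flip: a new index z changes the form Q to Q + L and Q - L, where L is
  linear in the old signs and \<open>rademacher_linear\<close> evaluates its second moment. Because
  c need not be symmetric, L has the coefficients c x z + c z x, and squaring this sum costs the
  factor 2.\<close>

lemma rademacher_chaos:
  fixes c :: "'a \<Rightarrow> 'a \<Rightarrow> real"
  assumes "finite S"
  shows "(\<Sum>A\<in>Pow S. (\<Sum>x\<in>S. \<Sum>y\<in>S - {x}. rad A x * rad A y * c x y)\<^sup>2)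
      \<le> 2 ^ card S * (2 * (\<Sum>x\<in>S. \<Sum>y\<in>S - {x}. (c x y)\<^sup>2))"
  using assms
proof (induction S rule: finite_induct)
  case (insert z S)
  have split: "(\<Sum>x\<in>insert z S. \<Sum>y\<in>insert z S - {x}. f x y)
      = (\<Sum>x\<in>S. \<Sum>y\<in>S - {x}. f x y) + (\<Sum>x\<in>S. f x z + f z x)" for f :: "'a \<Rightarrow> 'a \<Rightarrow> real"
  proof -
    have "(\<Sum>x\<in>insert z S. \<Sum>y\<in>insert z S - {x}. f x y)
        = (\<Sum>y\<in>S. f z y) + (\<Sum>x\<in>S. \<Sum>y\<in>insert z S - {x}. f x y)"
      using insert by (simp add: Diff_insert0)
    also have "(\<Sum>x\<in>S. \<Sum>y\<in>insert z S - {x}. f x y) = (\<Sum>x\<in>S. f x z + (\<Sum>y\<in>S - {x}. f x y))"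
    proof (intro sum.cong refl)
      fix x assume "x \<in> S"
      then have "insert z S - {x} = insert z (S - {x})" using insert by auto
      then show "(\<Sum>y\<in>insert z S - {x}. f x y) = f x z + (\<Sum>y\<in>S - {x}. f x y)"
        using insert by simp
    qed
    finally show ?thesis by (simp add: sum.distrib)
  qed
  define Q where "Q = (\<lambda>A. \<Sum>x\<in>S. \<Sum>y\<in>S - {x}. rad A x * rad A y * c x y)"
  define d where "d = (\<lambda>x. c x z + c z x)"
  define L where "L = (\<lambda>A. \<Sum>x\<in>S. rad A x * d x)"
  have "(\<Sum>A\<in>Pow (insert z S). (\<Sum>x\<in>insert z S. \<Sum>y\<in>insert z S - {x}. rad A x * rad A y * c x y)\<^sup>2)
      = (\<Sum>A\<in>Pow S. 2 * (Q A)\<^sup>2 + 2 * (L A)\<^sup>2)"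
    unfolding sum_Pow_insert[OF insert(1,2)]
  proof (intro sum.cong refl)
    fix A assume "A \<in> Pow S"
    then have z: "z \<notin> A" using insert by auto
    have r: "rad (insert z A) x = rad A x" if "x \<in> S" for x
      using that insert by (auto simp: rad_def)
    have "(\<Sum>x\<in>insert z S. \<Sum>y\<in>insert z S - {x}. rad A x * rad A y * c x y) = Q A + L A"
      unfolding split Q_def L_def d_def using z by (simp add: algebra_simps)
    moreover have "(\<Sum>x\<in>insert z S. \<Sum>y\<in>insert z S - {x}.
        rad (insert z A) x * rad (insert z A) y * c x y) = Q A - L A"
    proof -
      have "(\<Sum>x\<in>S. \<Sum>y\<in>S - {x}. rad (insert z A) x * rad (insert z A) y * c x y) = Q A"
        unfolding Q_def by (intro sum.cong refl) (simp add: r)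
      moreover have "(\<Sum>x\<in>S. rad (insert z A) x * rad (insert z A) z * c x z
          + rad (insert z A) z * rad (insert z A) x * c z x) = - L A"
        unfolding L_def d_def sum_negf[symmetric] using z
        by (intro sum.cong refl) (simp add: r algebra_simps)
      ultimately show ?thesis unfolding split by simp
    qed
    ultimately show "(\<Sum>x\<in>insert z S. \<Sum>y\<in>insert z S - {x}. rad A x * rad A y * c x y)\<^sup>2 +
        (\<Sum>x\<in>insert z S. \<Sum>y\<in>insert z S - {x}. rad (insert z A) x * rad (insert z A) y * c x y)\<^sup>2
        = 2 * (Q A)\<^sup>2 + 2 * (L A)\<^sup>2"
      by (simp only: power2_sum power2_diff)
  qed
  also have "\<dots> = 2 * (\<Sum>A\<in>Pow S. (Q A)\<^sup>2) + 2 * (2 ^ card S * (\<Sum>x\<in>S. (d x)\<^sup>2))"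
    unfolding L_def rademacher_linear[OF insert(1), symmetric]
    by (simp add: sum.distrib sum_distrib_left)
  also have "\<dots> \<le> 2 * (2 ^ card S * (2 * (\<Sum>x\<in>S. \<Sum>y\<in>S - {x}. (c x y)\<^sup>2)))
      + 2 * (2 ^ card S * (\<Sum>x\<in>S. 2 * ((c x z)\<^sup>2 + (c z x)\<^sup>2)))"
  proof -
    have "(d x)\<^sup>2 \<le> 2 * ((c x z)\<^sup>2 + (c z x)\<^sup>2)" for x
      unfolding d_def using sum_squares_bound[of "c x z" "c z x"] by (simp add: power2_sum)
    then show ?thesis
      using insert.IH unfolding Q_def by (intro add_mono mult_left_mono sum_mono) auto
  qed
  also have "\<dots> = 2 ^ card (insert z S) * (2 * (\<Sum>x\<in>insert z S. \<Sum>y\<in>insert z S - {x}. (c x y)\<^sup>2))"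
    unfolding split using insert by (simp add: sum_distrib_left[symmetric] sum.distrib distrib_left)
  finally show ?case .
qed simp

lemma exists_le_average:
  fixes f :: "'a \<Rightarrow> real"
  assumes "finite S" "S \<noteq> {}" "(\<Sum>x\<in>S. f x) \<le> real (card S) * c"
  shows "\<exists>x\<in>S. f x \<le> c"
proof (rule ccontr)
  assume "\<not> ?thesis"
  then have "(\<Sum>x\<in>S. c) < (\<Sum>x\<in>S. f x)" using assms by (intro sum_strict_mono) auto
  with assms show False by simp
qed

text \<open>Q is the sum of the powers of -P. The total absolute sum of P dominates every row sum,
  so the rows of the powers decay geometrically. Coefficient families are treated as row vectors,
  hence the order of the product Q P.\<close>

lemma neumann:
  fixes P :: "'a \<Rightarrow> 'a \<Rightarrow> real"
  assumes S: "finite S" and \<kappa>: "(\<Sum>I\<in>S. \<Sum>J\<in>S. \<bar>P I J\<bar>) \<le> \<kappa>" "\<kappa> < 1"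
  shows "\<exists>Q. \<forall>I\<in>S. \<forall>J\<in>S. Q I J + (\<Sum>K\<in>S. Q I K * P K J) = of_bool (I = J)"
proof -
  \<comment> \<open>\<open>M k\<close> is the k-th power of -P, built by multiplication from the
    right.\<close>
  define M where "M = rec_nat (\<lambda>I J. of_bool (I = J)) (\<lambda>_ X I J. \<Sum>K\<in>S. X I K * - P K J)"
  have M0: "M 0 I J = of_bool (I = J)" and
    MS: "M (Suc k) I J = (\<Sum>K\<in>S. M k I K * - P K J)" for k I J
    by (simp_all add: M_def)
  have "0 \<le> (\<Sum>I\<in>S. \<Sum>J\<in>S. \<bar>P I J\<bar>)" by (intro sum_nonneg) auto
  then have \<kappa>0: "0 \<le> \<kappa>" using \<kappa> by linarith
  have row: "(\<Sum>J\<in>S. \<bar>P I J\<bar>) \<le> \<kappa>" if "I \<in> S" for I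
    using member_le_sum[OF that, of "\<lambda>I. \<Sum>J\<in>S. \<bar>P I J\<bar>"] S \<kappa> by (auto intro: sum_nonneg)
  have bound: "(\<Sum>J\<in>S. \<bar>M k I J\<bar>) \<le> \<kappa> ^ k" if I: "I \<in> S" for k I
  proof (induction k)
    case 0
    show ?case using S I by (simp add: M0 of_bool_def if_distrib cong: if_cong)
  next
    case (Suc k)
    have "(\<Sum>J\<in>S. \<bar>M (Suc k) I J\<bar>) \<le> (\<Sum>J\<in>S. \<Sum>K\<in>S. \<bar>M k I K\<bar> * \<bar>P K J\<bar>)"
      unfolding MS by (intro sum_mono order_trans[OF sum_abs]) (simp add: abs_mult)
    also have "\<dots> = (\<Sum>K\<in>S. \<bar>M k I K\<bar> * (\<Sum>J\<in>S. \<bar>P K J\<bar>))"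
      by (subst sum.swap) (simp add: sum_distrib_left)
    also have "\<dots> \<le> (\<Sum>K\<in>S. \<bar>M k I K\<bar> * \<kappa>)"
      using row by (intro sum_mono mult_left_mono) auto
    also have "\<dots> \<le> \<kappa> ^ Suc k"
      using mult_right_mono[OF Suc \<kappa>0] by (simp add: sum_distrib_left[symmetric] mult.commute)
    finally show ?case .
  qed
  have summ: "summable (\<lambda>k. M k I J)" if "I \<in> S" "J \<in> S" for I J
  proof (rule summable_comparison_test'[of "\<lambda>k. \<kappa> ^ k" 0])
    show "summable (\<lambda>k. \<kappa> ^ k)" using \<kappa>0 \<kappa> by (intro summable_geometric) simp
    show "norm (M k I J) \<le> \<kappa> ^ k" for k
      using bound[OF that(1), of k] member_le_sum[OF that(2), of "\<lambda>J. \<bar>M k I J\<bar>"] S by simp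
  qed
  define Q where "Q = (\<lambda>I J. \<Sum>k. M k I J)"
  have "Q I J + (\<Sum>K\<in>S. Q I K * P K J) = of_bool (I = J)" if I: "I \<in> S" and J: "J \<in> S" for I J
  proof -
    \<comment> \<open>Multiplying the series by -P shifts it by one term.\<close>
    have "(\<Sum>K\<in>S. Q I K * - P K J) = (\<Sum>K\<in>S. \<Sum>k. M k I K * - P K J)"
      unfolding Q_def using summ I by (intro sum.cong refl suminf_mult2) auto
    also have "\<dots> = (\<Sum>k. M (Suc k) I J)"
      unfolding MS using summ I by (intro suminf_sum[symmetric] summable_mult2) auto
    also have "\<dots> = Q I J - M 0 I J"
      unfolding Q_def using suminf_split_head[OF summ[OF I J]] by simp
    finally show ?thesis by (simp add: M0 sum_negf)
  qed
  then show ?thesis by blast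
qed

section \<open>The discrete factorization\<close>

definition coeff_linear :: "((nat \<times> nat \<Rightarrow> real) \<Rightarrow> nat \<times> nat \<Rightarrow> real) \<Rightarrow> bool" where
  "coeff_linear E \<longleftrightarrow> (\<forall>a b. E (\<lambda>K. a K + b K) = (\<lambda>K. E a K + E b K)) \<and>
     (\<forall>c a. E (\<lambda>K. c * a K) = (\<lambda>K. c * E a K))"

context haar_norm
begin

text \<open>\<open>\<tau> K L\<close> is the coefficient of h_L in T h_K, so the pairing of T h_K
  with h_L is \<open>len L * \<tau> K L\<close>.\<close>

context
  fixes m n :: nat and \<Gamma> :: real and \<tau> :: "nat \<times> nat \<Rightarrow> nat \<times> nat \<Rightarrow> real"
  assumes \<Gamma>: "0 \<le> \<Gamma>"
    and bound: "\<And>a. \<nu> (m + n) (\<lambda>L. \<Sum>K\<in>idx (m + n). a K * \<tau> K L) \<le> \<Gamma> * \<nu> (m + n) a"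
begin

lemma unit_bound:
  assumes "K \<in> idx (m + n)"
  shows "\<nu> (m + n) (\<tau> K) \<le> \<Gamma> * len K powr \<theta>"
proof -
  have "(\<Sum>K'\<in>idx (m + n). of_bool (K' = K) * \<tau> K' L) = \<tau> K L" for L
    using assms by simp
  then show ?thesis using bound[of "\<lambda>L. of_bool (L = K)"] assms by (simp add: single)
qed

lemma entry_bound:
  assumes "K \<in> idx (m + n)" "L \<in> idx (m + n)"
  shows "\<bar>\<tau> K L\<bar> * len L powr \<theta> \<le> \<Gamma> * len K powr \<theta>"
  using coeff_le[OF assms(2), of "\<tau> K"] unit_bound[OF assms(1)] by linarith

lemma row_bound:
  assumes "K \<in> idx (m + n)" "j \<le> m + n"
  shows "(\<Sum>r<2^j. \<bar>\<tau> K (j, r)\<bar>) / 2 ^ j \<le> \<Gamma> * len K powr \<theta>"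
  using level_sum[OF assms(2), of "\<tau> K"] unit_bound[OF assms(1)] by linarith

text \<open>T is applied to the sum of level i whose signs are those of column L. This has norm at
  most 1, and in the image all absolute values of the column add up in the single coefficient at
  L.\<close>

lemma column_bound:
  assumes "L \<in> idx (m + n)" "i \<le> m + n"
  shows "(\<Sum>k<2^i. \<bar>\<tau> (i, k) L\<bar>) * len L powr \<theta> \<le> \<Gamma>"
proof -
  define a where "a = (\<lambda>K. of_bool (fst K = i) * sgn (\<tau> K L))"
  define b where "b = (\<lambda>L. \<Sum>K\<in>idx (m + n). a K * \<tau> K L)"
  have "\<nu> (m + n) a \<le> \<nu> (m + n) (\<lambda>K. of_bool (fst K = i))"
    by (intro mono) (simp add: a_def abs_mult sgn_real_def)
  also have "\<dots> \<le> 1" by (rule level_one[OF assms(2)])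
  finally have "\<nu> (m + n) b \<le> \<Gamma>"
    using bound[of a] \<Gamma> mult_left_mono[of "\<nu> (m + n) a" 1 \<Gamma>] unfolding b_def by simp
  have "b L = (\<Sum>j\<le>m + n. \<Sum>k<2^j. of_bool (j = i) * \<bar>\<tau> (j, k) L\<bar>)"
    unfolding b_def sum_idx by (intro sum.cong refl) (simp add: a_def abs_sgn mult_ac)
  also have "\<dots> = (\<Sum>k<2^i. \<bar>\<tau> (i, k) L\<bar>)"
    using assms(2) by (simp add: sum_distrib_left[symmetric])
  finally have "\<bar>b L\<bar> = (\<Sum>k<2^i. \<bar>\<tau> (i, k) L\<bar>)" by (simp add: sum_nonneg)
  then show ?thesis using coeff_le[OF assms(1), of b] \<open>\<nu> (m + n) b \<le> \<Gamma>\<close> by simp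
qed

text \<open>The squares are estimated by the largest entry times the total U, and U by the geometric
  mean of its row-wise and column-wise bounds.\<close>

lemma block_bound:
  assumes ij: "m \<le> i" "i \<le> m + n" "m \<le> j" "j \<le> m + n"
  shows "(\<Sum>k<2^i. \<Sum>r<2^j. (len (j, r) * \<tau> (i, k) (j, r))\<^sup>2) \<le> \<Gamma>\<^sup>2 * 2 ^ n * sqrt (1 / 2 ^ m)"
proof -
  \<comment> \<open>The norm of a Haar function of given level and, in the next line, its norm in
    the dual; their product is the length, whatever \<theta> is.\<close>
  define \<alpha> where "\<alpha> = (\<lambda>i::nat. (1 / 2 ^ i :: real) powr \<theta>)"
  define \<beta> where "\<beta> = (\<lambda>j::nat. (1 / 2 ^ j :: real) powr (1 - \<theta>))"
  have \<alpha>m: "\<alpha> i \<le> \<alpha> m" and \<beta>m: "\<beta> j \<le> \<beta> m"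
    unfolding \<alpha>_def \<beta>_def using ij theta
    by (auto intro!: powr_mono2 simp: field_simps)
  have pos: "\<alpha> i > 0" "\<beta> j > 0" for i j by (auto simp: \<alpha>_def \<beta>_def)
  have \<alpha>\<beta>: "\<beta> l = (1 / 2 ^ l) / \<alpha> l" for l by (simp add: \<alpha>_def \<beta>_def powr_diff)
  then have \<alpha>\<beta>': "\<alpha> l * \<beta> l = 1 / 2 ^ l" for l using pos(1)[of l] by simp
  define t where "t = (\<lambda>k r. \<bar>\<tau> (i, k) (j, r)\<bar> / 2 ^ j)"
  have tmax: "t k r \<le> \<Gamma> / 2 ^ m" if "k < 2 ^ i" "r < 2 ^ j" for k r
  proof -
    have "\<bar>\<tau> (i, k) (j, r)\<bar> * \<alpha> j \<le> \<Gamma> * \<alpha> i"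
      using entry_bound[of "(i, k)" "(j, r)"] that ij by (simp add: \<alpha>_def len_def)
    then have "t k r \<le> \<Gamma> * (\<alpha> i * \<beta> j)"
      unfolding t_def \<alpha>\<beta> using pos(1)[of j] by (simp add: field_simps)
    also have "\<dots> \<le> \<Gamma> * (\<alpha> m * \<beta> m)"
      using \<alpha>m \<beta>m pos[of m] pos[of i] pos[of j] \<Gamma>
      by (intro mult_left_mono mult_mono) (auto simp: less_imp_le)
    finally show ?thesis by (simp add: \<alpha>\<beta>')
  qed
  define U where "U = (\<Sum>k<2^i. \<Sum>r<2^j. t k r)"
  have U0: "0 \<le> U" unfolding U_def t_def by (intro sum_nonneg) auto
  have pow: "(2::real) ^ i \<le> 2 ^ (m + n)" "(2::real) ^ j \<le> 2 ^ (m + n)"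
    using ij by (auto intro!: power_increasing)
  have "U \<le> (\<Sum>k<(2::nat)^i. \<Gamma> * \<alpha> i)"
    unfolding U_def
  proof (intro sum_mono)
    fix k :: nat assume "k \<in> {..<2^i}"
    then show "(\<Sum>r<2^j. t k r) \<le> \<Gamma> * \<alpha> i"
      using row_bound[of "(i, k)" j] ij
      by (simp add: t_def sum_divide_distrib[symmetric] \<alpha>_def len_def)
  qed
  also have "\<dots> = 2 ^ i * (\<Gamma> * \<alpha> i)" by simp
  also have "\<dots> \<le> 2 ^ (m + n) * (\<Gamma> * \<alpha> m)"
    using pow \<alpha>m pos[of i] \<Gamma> by (intro mult_mono) (auto simp: less_imp_le)
  finally have U1: "U \<le> 2 ^ (m + n) * (\<Gamma> * \<alpha> m)" .
  have "U = (\<Sum>r<2^j. \<Sum>k<2^i. t k r)" unfolding U_def by (rule sum.swap)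
  also have "\<dots> \<le> (\<Sum>r<(2::nat)^j. \<Gamma> * \<beta> j)"
  proof (intro sum_mono)
    fix r :: nat assume "r \<in> {..<2^j}"
    then have "(\<Sum>k<2^i. \<bar>\<tau> (i, k) (j, r)\<bar>) * \<alpha> j \<le> \<Gamma>"
      using column_bound[of "(j, r)" i] ij by (simp add: \<alpha>_def len_def)
    then have "(\<Sum>k<2^i. \<bar>\<tau> (i, k) (j, r)\<bar>) \<le> \<Gamma> / \<alpha> j"
      using pos(1)[of j] by (simp add: field_simps)
    then have "(\<Sum>k<2^i. \<bar>\<tau> (i, k) (j, r)\<bar>) / 2 ^ j \<le> (\<Gamma> / \<alpha> j) / 2 ^ j"
      by (intro divide_right_mono) auto
    then show "(\<Sum>k<2^i. t k r) \<le> \<Gamma> * \<beta> j"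
      by (simp add: t_def sum_divide_distrib[symmetric] \<alpha>\<beta> mult.commute)
  qed
  also have "\<dots> = 2 ^ j * (\<Gamma> * \<beta> j)" by simp
  also have "\<dots> \<le> 2 ^ (m + n) * (\<Gamma> * \<beta> m)"
    using pow \<beta>m pos[of j] \<Gamma> by (intro mult_mono) (auto simp: less_imp_le)
  finally have U2: "U \<le> 2 ^ (m + n) * (\<Gamma> * \<beta> m)" .
  have "U\<^sup>2 \<le> (2 ^ (m + n) * (\<Gamma> * \<alpha> m)) * (2 ^ (m + n) * (\<Gamma> * \<beta> m))"
    unfolding power2_eq_square using U0 U1 U2 by (intro mult_mono) auto
  also have "\<dots> = (2 ^ (m + n) * \<Gamma>)\<^sup>2 * (\<alpha> m * \<beta> m)"
    by (simp add: power2_eq_square)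
  also have "\<dots> = (2 ^ (m + n) * \<Gamma> * sqrt (1 / 2 ^ m))\<^sup>2"
    by (simp add: \<alpha>\<beta>' power_mult_distrib)
  finally have U3: "U \<le> 2 ^ (m + n) * \<Gamma> * sqrt (1 / 2 ^ m)"
    by (rule power2_le_imp_le) (use \<Gamma> in auto)
  have "(\<Sum>k<2^i. \<Sum>r<2^j. (len (j, r) * \<tau> (i, k) (j, r))\<^sup>2) = (\<Sum>k<2^i. \<Sum>r<2^j. t k r * t k r)"
    by (intro sum.cong refl) (simp add: len_def t_def power2_eq_square)
  also have "\<dots> \<le> (\<Sum>k<2^i. \<Sum>r<2^j. \<Gamma> / 2 ^ m * t k r)"
    using tmax by (intro sum_mono mult_right_mono) (auto simp: t_def)
  also have "\<dots> = \<Gamma> / 2 ^ m * U" by (simp add: U_def sum_distrib_left)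
  also have "\<dots> \<le> \<Gamma> / 2 ^ m * (2 ^ (m + n) * \<Gamma> * sqrt (1 / 2 ^ m))"
    using U3 \<Gamma> by (intro mult_left_mono) auto
  also have "\<dots> = \<Gamma>\<^sup>2 * 2 ^ n * sqrt (1 / 2 ^ m)"
    by (simp add: power_add power2_eq_square)
  finally show ?thesis .
qed

section \<open>Second moments over the deep levels\<close>

definition deep :: "(nat \<times> nat) set" where
  "deep = Sigma {m..m + n} (\<lambda>j. {..<2 ^ j})"

lemma deep_eq: "deep = {K \<in> idx (m + n). m \<le> fst K}"
  by (auto simp: deep_def idx_def)

lemma sum_deep: "(\<Sum>K\<in>deep. f K) = (\<Sum>j=m..m+n. \<Sum>r<2^j. f (j, r))"
  unfolding deep_def by (subst sum.Sigma) auto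

lemma finite_deep [simp]: "finite deep"
  by (simp add: deep_def)

lemma fibre_deep: "I \<in> idx n \<Longrightarrow> fibre m I = {K \<in> deep. base m K = I}"
  unfolding deep_eq by (auto simp: fibre_eq)

lemma deep_bound:
  "(\<Sum>K\<in>deep. \<Sum>L\<in>deep. (len L * \<tau> K L)\<^sup>2) \<le> 4 ^ n * (\<Gamma>\<^sup>2 * 2 ^ n * sqrt (1 / 2 ^ m))"
proof -
  let ?M = "\<Gamma>\<^sup>2 * 2 ^ n * sqrt (1 / 2 ^ m)"
  have "(\<Sum>K\<in>deep. \<Sum>L\<in>deep. (len L * \<tau> K L)\<^sup>2)
      = (\<Sum>i=m..m+n. \<Sum>k<2^i. \<Sum>j=m..m+n. \<Sum>r<2^j. (len (j, r) * \<tau> (i, k) (j, r))\<^sup>2)"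
    by (simp only: sum_deep)
  also have "\<dots> = (\<Sum>i=m..m+n. \<Sum>j=m..m+n. \<Sum>k<2^i. \<Sum>r<2^j. (len (j, r) * \<tau> (i, k) (j, r))\<^sup>2)"
    by (rule sum.cong[OF refl], rule sum.swap)
  also have "\<dots> \<le> (\<Sum>i=m..m+n. \<Sum>j=m..m+n. ?M)"
    by (intro sum_mono block_bound) auto
  also have "\<dots> = (real (Suc n))\<^sup>2 * ?M" by (simp add: power2_eq_square)
  \<comment> \<open>There are (n + 1)^2 pairs of levels between m and m + n; rounding up to 4^n
    keeps the constants powers of two.\<close>
  also have "\<dots> \<le> 4 ^ n * ?M"
  proof (intro mult_right_mono)
    have "real (Suc n) \<le> 2 ^ n" by (induction n) auto
    then have "(real (Suc n))\<^sup>2 \<le> (2 ^ n)\<^sup>2" by (intro power_mono) auto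
    then show "(real (Suc n))\<^sup>2 \<le> 4 ^ n" by (simp add: power2_eq_square flip: power_mult_distrib)
  qed simp
  finally show ?thesis .
qed

text \<open>The part of the pairing of T b_I with b_J that comes from distinct K and L. For distinct
  I and J in \<open>idx n\<close> the fibres are disjoint and this is the whole pairing; for I = J
  the terms K = L, in which the signs cancel, are left out.\<close>

definition cross :: "(nat \<times> nat) set \<Rightarrow> nat \<times> nat \<Rightarrow> nat \<times> nat \<Rightarrow> real" where
  "cross A I J = (\<Sum>K\<in>fibre m I. \<Sum>L\<in>fibre m J - {K}. rad A K * rad A L * (len L * \<tau> K L))"

text \<open>Each \<open>cross A I J\<close> is a quadratic form in the signs. A pair K, L of deep
  intervals contributes only to the form belonging to its bases, so adding up the second moments
  over all I, J counts every entry at most once.\<close>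

lemma exists_signs:
  "\<exists>A. (\<Sum>I\<in>idx n. \<Sum>J\<in>idx n. (cross A I J)\<^sup>2) \<le> 2 * (4 ^ n * (\<Gamma>\<^sup>2 * 2 ^ n * sqrt (1 / 2 ^ m)))"
proof -
  \<comment> \<open>The forms are extended by zero to all of \<open>deep\<close>, so that one
    probability space of signs serves every I and J.\<close>
  define c where "c = (\<lambda>I J K L. of_bool (base m K = I) * of_bool (base m L = J) * (len L * \<tau> K L))"
  have cross: "cross A I J = (\<Sum>K\<in>deep. \<Sum>L\<in>deep - {K}. rad A K * rad A L * c I J K L)"
    if "I \<in> idx n" "J \<in> idx n" for A I J
  proof -
    have "cross A I J = (\<Sum>K\<in>fibre m I. \<Sum>L\<in>deep - {K}. rad A K * rad A L * c I J K L)"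
      unfolding cross_def
    proof (rule sum.cong[OF refl])
      fix K assume "K \<in> fibre m I"
      then have "base m K = I" using fibre_deep that by auto
      then show "(\<Sum>L\<in>fibre m J - {K}. rad A K * rad A L * (len L * \<tau> K L))
          = (\<Sum>L\<in>deep - {K}. rad A K * rad A L * c I J K L)"
        using that by (intro sum.mono_neutral_cong_left) (auto simp: fibre_deep c_def)
    qed
    also have "\<dots> = (\<Sum>K\<in>deep. \<Sum>L\<in>deep - {K}. rad A K * rad A L * c I J K L)"
      using that by (intro sum.mono_neutral_left) (auto simp: fibre_deep c_def)
    finally show ?thesis .
  qed
  have "(\<Sum>A\<in>Pow deep. \<Sum>I\<in>idx n. \<Sum>J\<in>idx n. (cross A I J)\<^sup>2)
      = (\<Sum>I\<in>idx n. \<Sum>A\<in>Pow deep. \<Sum>J\<in>idx n. (cross A I J)\<^sup>2)"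
    by (rule sum.swap)
  also have "\<dots> = (\<Sum>I\<in>idx n. \<Sum>J\<in>idx n. \<Sum>A\<in>Pow deep. (cross A I J)\<^sup>2)"
    by (rule sum.cong[OF refl], rule sum.swap)
  also have "\<dots> \<le> (\<Sum>I\<in>idx n. \<Sum>J\<in>idx n.
      2 ^ card deep * (2 * (\<Sum>K\<in>deep. \<Sum>L\<in>deep - {K}. (c I J K L)\<^sup>2)))"
    by (intro sum_mono) (simp only: cross rademacher_chaos[OF finite_deep])
  also have "\<dots> = 2 ^ card deep * (2 * (\<Sum>I\<in>idx n. \<Sum>J\<in>idx n. \<Sum>K\<in>deep. \<Sum>L\<in>deep - {K}. (c I J K L)\<^sup>2))"
    by (simp add: sum_distrib_left)
  also have "(\<Sum>I\<in>idx n. \<Sum>J\<in>idx n. \<Sum>K\<in>deep. \<Sum>L\<in>deep - {K}. (c I J K L)\<^sup>2)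
      = (\<Sum>I\<in>idx n. \<Sum>K\<in>deep. \<Sum>J\<in>idx n. \<Sum>L\<in>deep - {K}. (c I J K L)\<^sup>2)"
    by (rule sum.cong[OF refl], rule sum.swap)
  also have "\<dots> = (\<Sum>K\<in>deep. \<Sum>I\<in>idx n. \<Sum>J\<in>idx n. \<Sum>L\<in>deep - {K}. (c I J K L)\<^sup>2)"
    by (rule sum.swap)
  also have "\<dots> = (\<Sum>K\<in>deep. \<Sum>I\<in>idx n. \<Sum>L\<in>deep - {K}. \<Sum>J\<in>idx n. (c I J K L)\<^sup>2)"
    by (rule sum.cong[OF refl], rule sum.cong[OF refl], rule sum.swap)
  also have "\<dots> = (\<Sum>K\<in>deep. \<Sum>L\<in>deep - {K}. \<Sum>I\<in>idx n. \<Sum>J\<in>idx n. (c I J K L)\<^sup>2)"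
    by (rule sum.cong[OF refl], rule sum.swap)
  also have "\<dots> = (\<Sum>K\<in>deep. \<Sum>L\<in>deep - {K}. (len L * \<tau> K L)\<^sup>2)"
  proof (rule sum.cong[OF refl], rule sum.cong[OF refl])
    fix K L assume "K \<in> deep" "L \<in> deep - {K}"
    then have "base m K \<in> idx n" "base m L \<in> idx n"
      using base_in_idx by (auto simp: deep_eq)
    moreover have "(c I J K L)\<^sup>2 = (if base m L = J then if base m K = I then (len L * \<tau> K L)\<^sup>2 else 0 else 0)"
      for I J by (simp add: c_def)
    ultimately show "(\<Sum>I\<in>idx n. \<Sum>J\<in>idx n. (c I J K L)\<^sup>2) = (len L * \<tau> K L)\<^sup>2"
      by simp
  qed
  also have "\<dots> \<le> (\<Sum>K\<in>deep. \<Sum>L\<in>deep. (len L * \<tau> K L)\<^sup>2)"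
    by (intro sum_mono sum_mono2) auto
  also have "\<dots> \<le> 4 ^ n * (\<Gamma>\<^sup>2 * 2 ^ n * sqrt (1 / 2 ^ m))" by (rule deep_bound)
  finally have "(\<Sum>A\<in>Pow deep. \<Sum>I\<in>idx n. \<Sum>J\<in>idx n. (cross A I J)\<^sup>2)
      \<le> real (card (Pow deep)) * (2 * (4 ^ n * (\<Gamma>\<^sup>2 * 2 ^ n * sqrt (1 / 2 ^ m))))"
    by (simp add: card_Pow)
  from exists_le_average[OF _ _ this] show ?thesis by auto
qed

text \<open>In coefficients, signed copying followed by T and signed averaging is the matrix z plus
  the diagonal d. As the diagonal of \<tau> has one sign, the averages d J stay above \<delta>.
  Factoring out d leaves 1 + P; its inverse goes into E and the division by d into F, at the cost of
  1 / (1 - \<kappa>) and 1 / \<delta>.\<close>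

lemma factor_positive:
  assumes \<delta>: "0 < \<delta>" and diag: "\<And>K. K \<in> idx (m + n) \<Longrightarrow> \<delta> \<le> \<tau> K K"
    and \<kappa>: "0 \<le> \<kappa>" "\<kappa> < 1" "(\<Gamma> / \<delta>)\<^sup>2 * 2 ^ (9 * n + 3) * sqrt (1 / 2 ^ m) \<le> \<kappa>\<^sup>2"
  shows "\<exists>E F. coeff_linear E \<and> coeff_linear F \<and>
    (\<forall>a. \<forall>J\<in>idx n. F (\<lambda>L. \<Sum>K\<in>idx (m + n). E a K * \<tau> K L) J = a J) \<and>
    (\<forall>a. \<nu> (m + n) (E a) \<le> \<nu> n a / (1 - \<kappa>)) \<and>
    (\<forall>b. \<nu> n (F b) \<le> \<nu> (m + n) b / \<delta>)"
proof -
  obtain A where A: "(\<Sum>I\<in>idx n. \<Sum>J\<in>idx n. (cross A I J)\<^sup>2)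
      \<le> 2 * (4 ^ n * (\<Gamma>\<^sup>2 * 2 ^ n * sqrt (1 / 2 ^ m)))"
    using exists_signs by blast
  define d where "d = (\<lambda>J. (\<Sum>K\<in>fibre m J. \<tau> K K) / 2 ^ m)"
  define z where "z = (\<lambda>I J. (\<Sum>K\<in>fibre m I. \<Sum>L\<in>fibre m J - {K}. rad A K * rad A L * \<tau> K L) / 2 ^ m)"
  define P where "P = (\<lambda>I J. z I J / d J)"
  have d: "\<delta> \<le> d J" if "J \<in> idx n" for J
  proof -
    have "2 ^ m * \<delta> = (\<Sum>K\<in>fibre m J. \<delta>)" by simp
    also have "\<dots> \<le> (\<Sum>K\<in>fibre m J. \<tau> K K)"
      using fibre_sub[OF that] by (intro sum_mono diag) blast
    finally show ?thesis by (simp add: d_def field_simps)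
  qed
  have P_le: "\<bar>P I J\<bar> \<le> 2 ^ n / \<delta> * \<bar>cross A I J\<bar>" if J: "J \<in> idx n" for I J
  proof -
    have "cross A I J = (\<Sum>K\<in>fibre m I. \<Sum>L\<in>fibre m J - {K}. len J / 2 ^ m * (rad A K * rad A L * \<tau> K L))"
      unfolding cross_def by (intro sum.cong refl) (auto simp: len_fibre)
    also have "\<dots> = len J * z I J"
      by (simp add: z_def sum_distrib_left sum_divide_distrib)
    \<comment> \<open>\<open>z\<close> carries no length weight, so passing to it from
      \<open>cross\<close> costs at most the factor 2^n.\<close>
    finally have "z I J = 2 ^ fst J * cross A I J" by (simp add: len_def)
    moreover have "(2::real) ^ fst J \<le> 2 ^ n"
      using J by (cases J) (auto intro: power_increasing)
    ultimately have "\<bar>z I J\<bar> \<le> 2 ^ n * \<bar>cross A I J\<bar>"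
      by (simp add: abs_mult mult_right_mono)
    moreover have "\<bar>P I J\<bar> \<le> \<bar>z I J\<bar> / \<delta>"
      unfolding P_def abs_divide using d[OF J] \<delta> by (intro divide_left_mono) auto
    ultimately show ?thesis using \<delta> by (simp add: field_simps)
  qed
  define X where "X = (\<Sum>I\<in>idx n. \<Sum>J\<in>idx n. \<bar>cross A I J\<bar>)"
  have X0: "0 \<le> X" unfolding X_def by (intro sum_nonneg) auto
  have X2: "X\<^sup>2 \<le> \<Gamma>\<^sup>2 * 2 ^ (5 * n + 3) * sqrt (1 / 2 ^ m)"
  proof -
    \<comment> \<open>Cauchy-Schwarz against the constant 1 over all pairs, of which there are at
      most (2^(n+1))^2.\<close>
    have "X = (\<Sum>(I, J)\<in>idx n \<times> idx n. \<bar>cross A I J\<bar> * 1)"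
      by (simp add: X_def sum.cartesian_product)
    then have "X\<^sup>2 \<le> (\<Sum>(I, J)\<in>idx n \<times> idx n. (cross A I J)\<^sup>2) * (\<Sum>(I, J)\<in>idx n \<times> idx n. 1)"
      using Cauchy_Schwarz_ineq_sum[of "\<lambda>(I, J). \<bar>cross A I J\<bar>" "\<lambda>_. 1" "idx n \<times> idx n"]
      by (simp add: split_def)
    also have "\<dots> = (\<Sum>I\<in>idx n. \<Sum>J\<in>idx n. (cross A I J)\<^sup>2) * (real (card (idx n)))\<^sup>2"
      by (simp add: sum.cartesian_product split_def power2_eq_square card_cartesian_product)
    also have "\<dots> \<le> (2 * (4 ^ n * (\<Gamma>\<^sup>2 * 2 ^ n * sqrt (1 / 2 ^ m)))) * (2 ^ Suc n)\<^sup>2"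
    proof (intro mult_mono power_mono A)
      have "real (card (idx n)) \<le> real (2 ^ Suc n)" using card_idx by (simp only: of_nat_le_iff)
      then show "real (card (idx n)) \<le> 2 ^ Suc n" by simp
    qed auto
    also have "\<dots> = \<Gamma>\<^sup>2 * 2 ^ (5 * n + 3) * sqrt (1 / 2 ^ m)"
    proof -
      have "(2::real) * (4 ^ n * 2 ^ n) * (2 ^ Suc n)\<^sup>2 = 2 ^ (5 * n + 3)"
      proof -
        have "(4::real) ^ n = 2 ^ (2 * n)" by (simp add: power_mult)
        then have "(2::real) * (4 ^ n * 2 ^ n) * (2 ^ Suc n)\<^sup>2 = 2 ^ (1 + (2 * n + n) + Suc n * 2)"
          by (simp only: power_add power_mult power_one_right)
        also have "1 + (2 * n + n) + Suc n * 2 = 5 * n + 3" by simp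
        finally show ?thesis .
      qed
      then show ?thesis by (simp add: mult_ac)
    qed
    finally show ?thesis .
  qed
  \<comment> \<open>One 2^n of the 4^n is the length weight in \<open>P_le\<close>; the other is
    spent in \<open>q_le\<close> on bounding coefficients by the norm. Squaring raises the exponent
    5n + 3 by 4n.\<close>
  have \<kappa>X: "4 ^ n / \<delta> * X \<le> \<kappa>"
  proof (rule power2_le_imp_le[OF _ \<kappa>(1)])
    have "(4 ^ n / \<delta> * X)\<^sup>2 = (4 ^ n / \<delta>)\<^sup>2 * X\<^sup>2" by (rule power_mult_distrib)
    also have "\<dots> \<le> (4 ^ n / \<delta>)\<^sup>2 * (\<Gamma>\<^sup>2 * 2 ^ (5 * n + 3) * sqrt (1 / 2 ^ m))"
      by (intro mult_left_mono X2) simp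
    also have "\<dots> = (\<Gamma> / \<delta>)\<^sup>2 * 2 ^ (9 * n + 3) * sqrt (1 / 2 ^ m)"
    proof -
      have "(4 ^ n)\<^sup>2 * (2::real) ^ (5 * n + 3) = 2 ^ (9 * n + 3)"
      proof -
        have "(4::real) ^ n = 2 ^ (2 * n)" by (simp add: power_mult)
        then have "(4 ^ n)\<^sup>2 * (2::real) ^ (5 * n + 3) = 2 ^ (2 * n * 2 + (5 * n + 3))"
          by (simp only: power_add power_mult)
        then show ?thesis by (simp add: algebra_simps)
      qed
      then show ?thesis by (simp add: power_divide mult_ac)
    qed
    finally show "(4 ^ n / \<delta> * X)\<^sup>2 \<le> \<kappa>\<^sup>2" using \<kappa>(3) by linarith
  qed
  have P_sum: "2 ^ n * (\<Sum>I\<in>idx n. \<Sum>J\<in>idx n. \<bar>P I J\<bar>) \<le> \<kappa>"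
  proof -
    have "(\<Sum>I\<in>idx n. \<Sum>J\<in>idx n. \<bar>P I J\<bar>) \<le> (\<Sum>I\<in>idx n. \<Sum>J\<in>idx n. 2 ^ n / \<delta> * \<bar>cross A I J\<bar>)"
      by (intro sum_mono P_le)
    also have "\<dots> = 2 ^ n / \<delta> * X" by (simp add: X_def sum_distrib_left)
    finally have "2 ^ n * (\<Sum>I\<in>idx n. \<Sum>J\<in>idx n. \<bar>P I J\<bar>) \<le> 2 ^ n * (2 ^ n / \<delta> * X)"
      by (intro mult_left_mono) auto
    also have "\<dots> = 4 ^ n / \<delta> * X" by (simp flip: power_mult_distrib)
    finally show ?thesis using \<kappa>X by linarith
  qed
  have "(\<Sum>I\<in>idx n. \<Sum>J\<in>idx n. \<bar>P I J\<bar>) \<le> 2 ^ n * (\<Sum>I\<in>idx n. \<Sum>J\<in>idx n. \<bar>P I J\<bar>)"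
    using mult_right_mono[of 1 "2 ^ n" "\<Sum>I\<in>idx n. \<Sum>J\<in>idx n. \<bar>P I J\<bar>"]
    by (simp add: sum_nonneg)
  then have "(\<Sum>I\<in>idx n. \<Sum>J\<in>idx n. \<bar>P I J\<bar>) \<le> \<kappa>" using P_sum by linarith
  from neumann[OF finite_idx this \<kappa>(2)] obtain Q where
    Q: "\<And>I J. I \<in> idx n \<Longrightarrow> J \<in> idx n \<Longrightarrow> Q I J + (\<Sum>K\<in>idx n. Q I K * P K J) = of_bool (I = J)"
    by blast
  \<comment> \<open>The row vector a Q, which solves q + q P = a.\<close>
  define q where "q = (\<lambda>a J. \<Sum>I\<in>idx n. a I * Q I J)"
  have q: "q a J + (\<Sum>K\<in>idx n. q a K * P K J) = a J" if J: "J \<in> idx n" for a J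
  proof -
    have "(\<Sum>K\<in>idx n. q a K * P K J) = (\<Sum>K\<in>idx n. \<Sum>I\<in>idx n. a I * (Q I K * P K J))"
      by (simp add: q_def sum_distrib_right mult.assoc)
    also have "\<dots> = (\<Sum>I\<in>idx n. a I * (\<Sum>K\<in>idx n. Q I K * P K J))"
      by (subst sum.swap) (simp add: sum_distrib_left)
    finally have "q a J + (\<Sum>K\<in>idx n. q a K * P K J)
        = (\<Sum>I\<in>idx n. a I * (Q I J + (\<Sum>K\<in>idx n. Q I K * P K J)))"
      by (simp add: q_def distrib_left sum.distrib)
    also have "\<dots> = a J" using J by (simp add: Q)
    finally show ?thesis .
  qed
  have q_le: "\<nu> n (q a) \<le> \<nu> n a / (1 - \<kappa>)" for a
  proof -
    \<comment> \<open>The norm bound is read off from q = a - w rather than from the series: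
      \<open>w\<close> has norm at most \<kappa> times that of q, which is absorbed on the
      left.\<close>
    define w where "w = (\<lambda>J. \<Sum>K\<in>idx n. q a K * P K J)"
    have "\<nu> n w \<le> (\<Sum>J\<in>idx n. \<bar>w J\<bar> * len J powr \<theta>)" by (rule expand_le)
    also have "\<dots> \<le> (\<Sum>J\<in>idx n. \<Sum>K\<in>idx n. 2 ^ n * \<nu> n (q a) * \<bar>P K J\<bar>)"
    proof (rule sum_mono)
      fix J assume "J \<in> idx n"
      have "len J powr \<theta> \<le> 1" using theta len_le_1 by (simp add: powr_le1 less_imp_le)
      then have "\<bar>w J\<bar> * len J powr \<theta> \<le> \<bar>w J\<bar>" by (simp add: mult_left_le)
      also have "\<dots> \<le> (\<Sum>K\<in>idx n. \<bar>q a K\<bar> * \<bar>P K J\<bar>)"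
        unfolding w_def abs_mult[symmetric] by (rule sum_abs)
      also have "\<dots> \<le> (\<Sum>K\<in>idx n. 2 ^ n * \<nu> n (q a) * \<bar>P K J\<bar>)"
      proof (intro sum_mono mult_right_mono)
        fix K assume K: "K \<in> idx n"
        \<comment> \<open>The worst case of the weight: level n and \<theta> = 1.\<close>
        have "1 / 2 ^ n \<le> len K"
          using K by (cases K) (auto simp: len_def intro!: divide_left_mono power_increasing)
        also have "len K = len K powr 1" by simp
        also have "\<dots> \<le> len K powr \<theta>"
          using theta len_le_1 by (intro powr_mono') (auto simp: less_imp_le)
        finally have "\<bar>q a K\<bar> * (1 / 2 ^ n) \<le> \<bar>q a K\<bar> * len K powr \<theta>"
          by (intro mult_left_mono) auto
        also have "\<dots> \<le> \<nu> n (q a)" by (rule coeff_le[OF K])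
        finally show "\<bar>q a K\<bar> \<le> 2 ^ n * \<nu> n (q a)" by (simp add: field_simps)
      qed auto
      finally show "\<bar>w J\<bar> * len J powr \<theta> \<le> (\<Sum>K\<in>idx n. 2 ^ n * \<nu> n (q a) * \<bar>P K J\<bar>)" .
    qed
    also have "\<dots> = \<nu> n (q a) * (2 ^ n * (\<Sum>K\<in>idx n. \<Sum>J\<in>idx n. \<bar>P K J\<bar>))"
      by (subst sum.swap) (simp add: sum_distrib_left mult_ac)
    also have "\<dots> \<le> \<nu> n (q a) * \<kappa>" by (intro mult_left_mono P_sum nonneg)
    finally have w: "\<nu> n w \<le> \<nu> n (q a) * \<kappa>" .
    have "\<nu> n (q a) = \<nu> n (\<lambda>J. a J + -1 * w J)"
    proof (rule cong)
      fix J assume "J \<in> idx n"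
      from q[OF this, of a] show "\<bar>q a J\<bar> = \<bar>a J + -1 * w J\<bar>" by (simp add: w_def)
    qed
    also have "\<dots> \<le> \<nu> n a + \<nu> n (\<lambda>J. -1 * w J)" by (rule triangle)
    also have "\<dots> = \<nu> n a + \<nu> n w" using homog[of n "-1" w] by simp
    finally have "\<nu> n (q a) * (1 - \<kappa>) \<le> \<nu> n a" using w by (simp add: algebra_simps)
    then show ?thesis using \<kappa> by (simp add: field_simps)
  qed
  define E where "E = (\<lambda>a K. rad A K * dil m (q a) K)"
  define F where "F = (\<lambda>b J. avg m (\<lambda>K. rad A K * b K) J / (if J \<in> idx n then d J else 1))"
  have linE: "coeff_linear E"
    unfolding coeff_linear_def E_def dil_def q_def
    by (auto simp: fun_eq_iff algebra_simps sum.distrib sum_distrib_left)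
  have linF: "coeff_linear F"
    unfolding coeff_linear_def F_def avg_def
    by (auto simp: fun_eq_iff algebra_simps sum.distrib sum_distrib_left add_divide_distrib)
  have FE: "F (\<lambda>L. \<Sum>K\<in>idx (m + n). E a K * \<tau> K L) J = a J" if J: "J \<in> idx n" for a J
  proof -
    \<comment> \<open>Distinct I and J have disjoint fibres, so diagonal terms occur only for I = J;
      there the two equal signs multiply to 1.\<close>
    have zz: "(\<Sum>L\<in>fibre m J. \<Sum>K\<in>fibre m I. rad A K * rad A L * \<tau> K L) / 2 ^ m
        = z I J + of_bool (I = J) * d J" if I: "I \<in> idx n" for I
    proof -
      have "(\<Sum>L\<in>fibre m J. \<Sum>K\<in>fibre m I. rad A K * rad A L * \<tau> K L)
          = (\<Sum>K\<in>fibre m I. \<Sum>L\<in>fibre m J. rad A K * rad A L * \<tau> K L)" by (rule sum.swap)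
      also have "\<dots> = (\<Sum>K\<in>fibre m I. (\<Sum>L\<in>fibre m J - {K}. rad A K * rad A L * \<tau> K L)
          + of_bool (I = J) * \<tau> K K)"
      proof (rule sum.cong[OF refl])
        fix K assume "K \<in> fibre m I"
        then have "K \<in> fibre m J \<longleftrightarrow> I = J" using I J by (auto simp: fibre_eq)
        then show "(\<Sum>L\<in>fibre m J. rad A K * rad A L * \<tau> K L)
            = (\<Sum>L\<in>fibre m J - {K}. rad A K * rad A L * \<tau> K L) + of_bool (I = J) * \<tau> K K"
          by (cases "I = J") (simp_all add: sum.remove[where x = K])
      qed
      finally show ?thesis
        by (simp add: z_def d_def sum.distrib add_divide_distrib sum_distrib_left)
    qed
    have "avg m (\<lambda>L. rad A L * (\<Sum>K\<in>idx (m + n). E a K * \<tau> K L)) J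
        = (\<Sum>L\<in>fibre m J. \<Sum>I\<in>idx n. \<Sum>K\<in>fibre m I. rad A L * (E a K * \<tau> K L)) / 2 ^ m"
      unfolding avg_def sum_distrib_left
      by (subst sum_by_fibres) (auto simp: E_def dil_def)
    also have "\<dots> = (\<Sum>L\<in>fibre m J. \<Sum>I\<in>idx n. \<Sum>K\<in>fibre m I. q a I * (rad A K * rad A L * \<tau> K L)) / 2 ^ m"
      by (intro arg_cong[where f = "\<lambda>x. x / 2 ^ m"] sum.cong refl) (simp add: E_def dil_fibre)
    also have "\<dots> = (\<Sum>I\<in>idx n. q a I * ((\<Sum>L\<in>fibre m J. \<Sum>K\<in>fibre m I. rad A K * rad A L * \<tau> K L) / 2 ^ m))"
      by (subst sum.swap) (simp add: sum_distrib_left sum_divide_distrib)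
    also have "\<dots> = (\<Sum>I\<in>idx n. q a I * (z I J + of_bool (I = J) * d J))"
      by (intro sum.cong refl) (simp add: zz)
    also have "\<dots> = (\<Sum>I\<in>idx n. q a I * (P I J * d J)) + q a J * d J"
    proof -
      have "(\<Sum>I\<in>idx n. q a I * (of_bool (I = J) * d J)) = (\<Sum>I\<in>idx n. if I = J then q a J * d J else 0)"
        by (intro sum.cong) auto
      also have "\<dots> = q a J * d J" using J by simp
      finally show ?thesis
        using d[OF J] \<delta> by (simp add: distrib_left sum.distrib P_def)
    qed
    also have "\<dots> = (q a J + (\<Sum>I\<in>idx n. q a I * P I J)) * d J"
      by (simp add: algebra_simps sum_distrib_left)
    also have "\<dots> = a J * d J" using q[OF J] by simp
    finally show ?thesis using J d[OF J] \<delta> by (simp add: F_def)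
  qed
  have E_le: "\<nu> (m + n) (E a) \<le> \<nu> n a / (1 - \<kappa>)" for a
  proof -
    have "\<nu> (m + n) (E a) = \<nu> (m + n) (dil m (q a))"
      by (intro cong) (simp add: E_def abs_mult)
    then show ?thesis using dilate[of m n "q a"] q_le[of a] by linarith
  qed
  have F_le: "\<nu> n (F b) \<le> \<nu> (m + n) b / \<delta>" for b
  proof -
    have "\<nu> n (F b) \<le> \<nu> n (\<lambda>J. 1 / \<delta> * avg m (\<lambda>K. rad A K * b K) J)"
    proof (rule mono)
      fix J assume J: "J \<in> idx n"
      show "\<bar>F b J\<bar> \<le> \<bar>1 / \<delta> * avg m (\<lambda>K. rad A K * b K) J\<bar>"
        using J d[OF J] \<delta> by (simp add: F_def divide_left_mono)
    qed
    also have "\<dots> = \<nu> n (avg m (\<lambda>K. rad A K * b K)) / \<delta>"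
      using \<delta> by (simp only: homog) simp
    also have "\<dots> \<le> \<nu> (m + n) (\<lambda>K. rad A K * b K) / \<delta>"
      using \<delta> by (intro divide_right_mono average) simp
    also have "\<nu> (m + n) (\<lambda>K. rad A K * b K) = \<nu> (m + n) b"
      by (intro cong) (simp add: abs_mult)
    finally show ?thesis .
  qed
  show ?thesis using linE linF FE E_le F_le by blast
qed

end

text \<open>The signs of the diagonal are moved into the embedding.\<close>

theorem factor:
  fixes \<tau> :: "nat \<times> nat \<Rightarrow> nat \<times> nat \<Rightarrow> real"
  assumes \<Gamma>: "0 \<le> \<Gamma>"
    and bound: "\<And>a. \<nu> (m + n) (\<lambda>L. \<Sum>K\<in>idx (m + n). a K * \<tau> K L) \<le> \<Gamma> * \<nu> (m + n) a"
    and \<delta>: "0 < \<delta>" and diag: "\<And>K. K \<in> idx (m + n) \<Longrightarrow> \<delta> \<le> \<bar>\<tau> K K\<bar>"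
    and \<kappa>: "0 \<le> \<kappa>" "\<kappa> < 1" "(\<Gamma> / \<delta>)\<^sup>2 * 2 ^ (9 * n + 3) * sqrt (1 / 2 ^ m) \<le> \<kappa>\<^sup>2"
  shows "\<exists>E F. coeff_linear E \<and> coeff_linear F \<and>
    (\<forall>a. \<forall>J\<in>idx n. F (\<lambda>L. \<Sum>K\<in>idx (m + n). E a K * \<tau> K L) J = a J) \<and>
    (\<forall>a. \<nu> (m + n) (E a) \<le> \<nu> n a / (1 - \<kappa>)) \<and>
    (\<forall>b. \<nu> n (F b) \<le> \<nu> (m + n) b / \<delta>)"
proof -
  define \<tau>' where "\<tau>' = (\<lambda>K L. sgn (\<tau> K K) * \<tau> K L)"
  have bound': "\<nu> (m + n) (\<lambda>L. \<Sum>K\<in>idx (m + n). a K * \<tau>' K L) \<le> \<Gamma> * \<nu> (m + n) a" for a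
  proof -
    have "\<nu> (m + n) (\<lambda>L. \<Sum>K\<in>idx (m + n). (a K * sgn (\<tau> K K)) * \<tau> K L)
        \<le> \<Gamma> * \<nu> (m + n) (\<lambda>K. a K * sgn (\<tau> K K))" by (rule bound)
    also have "\<dots> \<le> \<Gamma> * \<nu> (m + n) a"
      by (intro mult_left_mono mono \<Gamma>) (simp add: abs_mult sgn_real_def)
    finally show ?thesis by (simp add: \<tau>'_def mult.assoc)
  qed
  have diag': "\<delta> \<le> \<tau>' K K" if "K \<in> idx (m + n)" for K
    using diag[OF that] by (simp add: \<tau>'_def abs_sgn mult.commute)
  from factor_positive[OF \<Gamma> bound' \<delta> diag' \<kappa>] obtain E F where
    E: "coeff_linear E" and F: "coeff_linear F" and
    FE: "\<And>a J. J \<in> idx n \<Longrightarrow> F (\<lambda>L. \<Sum>K\<in>idx (m + n). E a K * \<tau>' K L) J = a J" and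
    E_le: "\<And>a. \<nu> (m + n) (E a) \<le> \<nu> n a / (1 - \<kappa>)" and
    F_le: "\<And>b. \<nu> n (F b) \<le> \<nu> (m + n) b / \<delta>" by blast
  define E' where "E' = (\<lambda>a K. sgn (\<tau> K K) * E a K)"
  have "coeff_linear E'"
    using E unfolding coeff_linear_def E'_def by (auto simp: fun_eq_iff algebra_simps)
  moreover have "\<nu> (m + n) (E' a) \<le> \<nu> n a / (1 - \<kappa>)" for a
  proof -
    have "\<nu> (m + n) (E' a) \<le> \<nu> (m + n) (E a)"
      by (intro mono) (simp add: E'_def abs_mult sgn_real_def)
    then show ?thesis using E_le[of a] by linarith
  qed
  moreover have "F (\<lambda>L. \<Sum>K\<in>idx (m + n). E' a K * \<tau> K L) J = a J" if "J \<in> idx n" for a J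
    using FE[OF that, of a] by (simp add: E'_def \<tau>'_def mult_ac)
  ultimately show ?thesis using F F_le by blast
qed

text \<open>Tests T on h_K alone. With the lower bound on the diagonal this forces \<delta> \<le>
  \<Gamma>, hence nonnegative logarithms in the choice of N.\<close>

lemma diagonal_le:
  fixes \<tau> :: "nat \<times> nat \<Rightarrow> nat \<times> nat \<Rightarrow> real"
  assumes bound: "\<And>a. \<nu> k (\<lambda>L. \<Sum>K\<in>idx k. a K * \<tau> K L) \<le> \<Gamma> * \<nu> k a"
    and K: "K \<in> idx k"
  shows "\<bar>\<tau> K K\<bar> \<le> \<Gamma>"
proof -
  have "(\<Sum>K'\<in>idx k. of_bool (K' = K) * \<tau> K' L) = \<tau> K L" for L using K by simp
  then have "\<nu> k (\<tau> K) \<le> \<Gamma> * len K powr \<theta>"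
    using bound[of "\<lambda>L. of_bool (L = K)"] K by (simp add: single)
  then have "\<bar>\<tau> K K\<bar> * len K powr \<theta> \<le> \<Gamma> * len K powr \<theta>"
    using coeff_le[OF K, of "\<tau> K"] by linarith
  then show ?thesis by simp
qed

end

lemma level_choice:
  fixes \<delta> \<Gamma> \<eta> :: real
  assumes "0 < \<delta>" "\<delta> \<le> \<Gamma>" "0 < \<eta>"
    and N: "int N = 19 * (int n + 2) + \<lfloor>4 * log 2 (\<Gamma> / \<delta>) + 4 * log 2 (1 + inverse \<eta>)\<rfloor>"
  obtains m where "N = m + n" "(\<Gamma> / \<delta>)\<^sup>2 * 2 ^ (9 * n + 3) * sqrt (1 / 2 ^ m) \<le> (\<eta> / (1 + \<eta>))\<^sup>2"
proof -
  \<comment> \<open>Merges the two logarithms; 1 + 1/\<eta> is the reciprocal of the admissible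
    perturbation \<eta> / (1 + \<eta>).\<close>
  define R where "R = \<Gamma> / \<delta> * (1 + inverse \<eta>)"
  have "1 \<le> \<Gamma> / \<delta>" using assms by simp
  then have R1: "1 \<le> R" unfolding R_def using assms mult_mono[of 1 "\<Gamma> / \<delta>" 1 "1 + inverse \<eta>"] by simp
  have "0 < \<Gamma> / \<delta>" "0 < 1 + inverse \<eta>" using assms by (auto intro: add_pos_pos)
  then have "4 * log 2 (\<Gamma> / \<delta>) + 4 * log 2 (1 + inverse \<eta>) = 4 * log 2 R"
    unfolding R_def by (subst log_mult) auto
  then have N': "int N = 19 * (int n + 2) + \<lfloor>4 * log 2 R\<rfloor>" using N by simp
  have "0 \<le> log 2 R" using R1 by simp
  then have "0 \<le> \<lfloor>4 * log 2 R\<rfloor>" by simp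
  then have "int n \<le> int N" unfolding N' by simp
  then have "n \<le> N" by simp
  then obtain m where m: "N = m + n" by (metis le_add_diff_inverse2)
  have "real_of_int (int N) = 19 * (real n + 2) + of_int \<lfloor>4 * log 2 R\<rfloor>"
    unfolding N' by simp
  \<comment> \<open>The floor loses less than 1, well within the reserve that the additive 38 leaves
    over the 6 required.\<close>
  then have "4 * log 2 R - 1 + 19 * (real n + 2) \<le> real m + real n" using m by simp linarith
  then have "2 * log 2 R + real (9 * n + 3) \<le> real m / 2" by simp
  then have "2 powr (2 * log 2 R + real (9 * n + 3)) \<le> 2 powr (real m / 2)"
    by (intro powr_mono) auto
  moreover have "2 powr (2 * log 2 R) = R\<^sup>2"
    using R1 powr_powr[of 2 "log 2 R" 2] by (simp add: mult.commute powr_numeral)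
  moreover have "2 powr (real m / 2) = sqrt (2 ^ m)"
    using powr_half_sqrt_powr[of 2 "real m"] by (simp add: powr_realpow)
  moreover have "2 powr real (9 * n + 3) = (2::real) ^ (9 * n + 3)" by (rule powr_realpow) simp
  ultimately have le: "R\<^sup>2 * 2 ^ (9 * n + 3) \<le> sqrt (2 ^ m)"
    by (simp only: powr_add)
  have "(\<Gamma> / \<delta>)\<^sup>2 * 2 ^ (9 * n + 3) / sqrt (2 ^ m) \<le> (\<eta> / (1 + \<eta>))\<^sup>2"
  proof -
    have "\<Gamma> / \<delta> = R * (\<eta> / (1 + \<eta>))" 
    proof -
      have e: "(1 + inverse \<eta>) * (\<eta> / (1 + \<eta>)) = 1"
        using assms by (simp add: inverse_eq_divide add_divide_distrib[symmetric] add_divide_eq_iff)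
      show ?thesis unfolding R_def mult.assoc e by simp
    qed
    then have "(\<Gamma> / \<delta>)\<^sup>2 * 2 ^ (9 * n + 3) = (\<eta> / (1 + \<eta>))\<^sup>2 * (R\<^sup>2 * 2 ^ (9 * n + 3))"
      by (simp only: power_mult_distrib mult_ac)
    also have "\<dots> \<le> (\<eta> / (1 + \<eta>))\<^sup>2 * sqrt (2 ^ m)" by (intro mult_left_mono le) simp
    finally show ?thesis by (simp add: divide_le_eq)
  qed
  then show ?thesis using that m by (simp add: real_sqrt_divide)
qed

section \<open>Means of square functions\<close>

text \<open>The value of the square function on the s-th interval of level k:
  \<open>s div 2 ^ (k - j)\<close> is the ancestor at level j, and |h_K| = 1 on K. Signs do not
  enter, so level k suffices although h_K may change sign at level k + 1.\<close>

definition sqf :: "nat \<Rightarrow> (nat \<times> nat \<Rightarrow> real) \<Rightarrow> nat \<Rightarrow> real" where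
  "sqf k a s = L2_set (\<lambda>j. a (j, s div 2 ^ (k - j))) {..k}"

lemma sqf_nonneg [simp]: "0 \<le> sqf k a s"
  by (simp add: sqf_def)

text \<open>\<open>u\<close> selects an interval of level m, and \<open>v\<close> a cell inside
  it.\<close>

lemma sum_split_pow: "(\<Sum>s<2 ^ (m + n). f s) = (\<Sum>u<2 ^ m. \<Sum>v<2 ^ n. f (u * 2 ^ n + v :: nat))"
proof -
  have "(\<Sum>s<2 ^ (m + n). f s) = (\<Sum>u<2 ^ m. sum f {u * 2 ^ n..<u * 2 ^ n + 2 ^ n})"
    by (simp add: sum.nat_group power_add)
  also have "\<dots> = (\<Sum>u<2 ^ m. \<Sum>v<2 ^ n. f (u * 2 ^ n + v))"
  proof (rule sum.cong[OF refl])
    fix u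
    show "sum f {u * 2 ^ n..<u * 2 ^ n + 2 ^ n} = (\<Sum>v<2 ^ n. f (u * 2 ^ n + v))"
      using sum.shift_bounds_nat_ivl[of f 0 "u * 2 ^ n" "2 ^ n"]
      by (simp add: lessThan_atLeast0 add.commute)
  qed
  finally show ?thesis .
qed

lemma sum_div_pow:
  fixes f :: "nat \<Rightarrow> real"
  assumes "j \<le> k"
  shows "(\<Sum>s<2 ^ k. f (s div 2 ^ (k - j))) = 2 ^ (k - j) * (\<Sum>r<2 ^ j. f r)"
proof -
  obtain l where k: "k = j + l" using assms le_Suc_ex by blast
  have "(\<Sum>s<2 ^ (j + l). f (s div 2 ^ l)) = (\<Sum>u<2 ^ j. \<Sum>v<2 ^ l. f ((u * 2 ^ l + v) div 2 ^ l))"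
    by (rule sum_split_pow)
  also have "\<dots> = (\<Sum>u<2 ^ j. \<Sum>v<(2::nat) ^ l. f u)" by (intro sum.cong refl) simp
  finally show ?thesis by (simp add: k sum_distrib_left)
qed

lemma div_pow_less: "s < 2 ^ k \<Longrightarrow> j \<le> k \<Longrightarrow> s div 2 ^ (k - j) < (2::nat) ^ j"
  by (metis le_add_diff_inverse2 less_mult_imp_div_less power_add add.commute)

lemma L2_set_sum_le: "L2_set (\<lambda>i. \<Sum>u\<in>U. f u i) A \<le> (\<Sum>u\<in>U. L2_set (f u) A)"
proof (induction U rule: infinite_finite_induct)
  case (insert x U)
  then show ?case using L2_set_triangle_ineq[of "f x" "\<lambda>i. \<Sum>u\<in>U. f u i" A] by simp
qed (simp_all add: L2_set_def)

lemma member_le_L2: "finite A \<Longrightarrow> i \<in> A \<Longrightarrow> \<bar>f i\<bar> \<le> L2_set f A"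
  unfolding L2_set_def
  using member_le_sum[of i A "\<lambda>i. (f i)\<^sup>2"] by (intro real_le_rsqrt) simp

text \<open>The Hardy and SL norms are means of the square function over 2^k equal cells, of L^p and
  of maximum type; the locale collects what is needed of the mean. \<open>periodic\<close> says that
  repeating a function does not enlarge its mean, and \<open>average\<close> is a form of Jensen's
  inequality.\<close>

locale mean_norm =
  fixes \<rho> :: "nat \<Rightarrow> (nat \<Rightarrow> real) \<Rightarrow> real" and \<theta> :: real
  assumes theta: "0 \<le> \<theta>" "\<theta> \<le> 1"
    and mono: "(\<And>s. s < 2 ^ k \<Longrightarrow> 0 \<le> f s) \<Longrightarrow> (\<And>s. s < 2 ^ k \<Longrightarrow> f s \<le> g s) \<Longrightarrow> \<rho> k f \<le> \<rho> k g"
    and triangle: "(\<And>s. 0 \<le> f s) \<Longrightarrow> (\<And>s. 0 \<le> g s) \<Longrightarrow> \<rho> k (\<lambda>s. f s + g s) \<le> \<rho> k f + \<rho> k g"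
    and homog: "(\<And>s. 0 \<le> f s) \<Longrightarrow> 0 \<le> c \<Longrightarrow> \<rho> k (\<lambda>s. c * f s) = c * \<rho> k f"
    and ind: "j \<le> k \<Longrightarrow> r < 2 ^ j \<Longrightarrow> \<rho> k (\<lambda>s. of_bool (s div 2 ^ (k - j) = r)) = (1 / 2 ^ j) powr \<theta>"
    and periodic: "(\<And>s. 0 \<le> f s) \<Longrightarrow> \<rho> (m + n) (\<lambda>s. f (s mod 2 ^ n)) \<le> \<rho> n f"
    and average: "(\<And>s. 0 \<le> f s) \<Longrightarrow> \<rho> n (\<lambda>s. (\<Sum>u<2^m. f (u * 2 ^ n + s)) / 2 ^ m) \<le> \<rho> (m + n) f"
begin

lemma cong: "(\<And>s. s < 2 ^ k \<Longrightarrow> 0 \<le> f s) \<Longrightarrow> (\<And>s. s < 2 ^ k \<Longrightarrow> f s = g s) \<Longrightarrow> \<rho> k f = \<rho> k g"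
  by (intro antisym mono) auto

lemma one: "\<rho> k (\<lambda>s. 1) = 1"
proof -
  have "\<rho> k (\<lambda>s. 1) = \<rho> k (\<lambda>s. of_bool (s div 2 ^ (k - 0) = 0))" by (rule cong) auto
  then show ?thesis using ind[of 0 k 0] by simp
qed

text \<open>\<open>average\<close> with n = 0 averages over all cells at once and leaves a constant,
  whose mean is its value.\<close>

lemma mean_le:
  assumes "\<And>s. 0 \<le> f s"
  shows "(\<Sum>s<2 ^ k. f s) / 2 ^ k \<le> \<rho> k f"
proof -
  let ?c = "(\<Sum>s<2 ^ k. f s) / 2 ^ k"
  have "0 \<le> ?c" using assms by (simp add: sum_nonneg)
  then have "?c = \<rho> 0 (\<lambda>s. ?c * 1)" using homog[of "\<lambda>s. 1" ?c 0] one[of 0] by simp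
  also have "\<dots> = \<rho> 0 (\<lambda>s. (\<Sum>u<2^k. f (u * 2 ^ 0 + s)) / 2 ^ k)"
    using assms by (intro cong) (auto simp: sum_nonneg)
  also have "\<dots> \<le> \<rho> (k + 0) f" using assms by (rule average)
  finally show ?thesis by simp
qed

text \<open>The main axioms reduce to pointwise facts: a coefficient is dominated by the square
  function (\<open>level_sum\<close>), dilated coefficients give its periodic repetition
  (\<open>dilate\<close>), and the triangle inequality in l2 takes the mean over copies outside
  (\<open>average\<close>).\<close>

lemma haar_norm: "haar_norm (\<lambda>k a. \<rho> k (sqf k a)) \<theta>"
proof
  show "0 \<le> \<theta>" "\<theta> \<le> 1" by (fact theta)+
next
  fix k and a b :: "nat \<times> nat \<Rightarrow> real" assume ab: "\<And>K. K \<in> idx k \<Longrightarrow> \<bar>a K\<bar> \<le> \<bar>b K\<bar>"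
  show "\<rho> k (sqf k a) \<le> \<rho> k (sqf k b)"
  proof (rule mono)
    fix s :: nat assume s: "s < 2 ^ k"
    show "sqf k a s \<le> sqf k b s"
      unfolding sqf_def L2_set_def
    proof (intro real_sqrt_le_mono sum_mono)
      fix j assume "j \<in> {..k}"
      then show "(a (j, s div 2 ^ (k - j)))\<^sup>2 \<le> (b (j, s div 2 ^ (k - j)))\<^sup>2"
        using ab[of "(j, s div 2 ^ (k - j))"] div_pow_less[OF s] by (simp add: abs_le_square_iff)
    qed
  qed simp
next
  fix k and a b :: "nat \<times> nat \<Rightarrow> real"
  have "\<rho> k (sqf k (\<lambda>K. a K + b K)) \<le> \<rho> k (\<lambda>s. sqf k a s + sqf k b s)"
    by (intro mono) (simp_all add: sqf_def L2_set_triangle_ineq)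
  also have "\<dots> \<le> \<rho> k (sqf k a) + \<rho> k (sqf k b)" by (intro triangle) auto
  finally show "\<rho> k (sqf k (\<lambda>K. a K + b K)) \<le> \<rho> k (sqf k a) + \<rho> k (sqf k b)" .
next
  fix k c and a :: "nat \<times> nat \<Rightarrow> real"
  have "sqf k (\<lambda>K. c * a K) = (\<lambda>s. \<bar>c\<bar> * sqf k a s)"
    by (simp add: fun_eq_iff sqf_def L2_set_def power_mult_distrib sum_distrib_left[symmetric] real_sqrt_mult)
  then show "\<rho> k (sqf k (\<lambda>K. c * a K)) = \<bar>c\<bar> * \<rho> k (sqf k a)" by (simp add: homog)
next
  fix K k assume K: "K \<in> idx k"
  obtain j r where jr: "K = (j, r)" by force
  have "sqf k (\<lambda>L. of_bool (L = K)) s = of_bool (s div 2 ^ (k - j) = r)" for s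
  proof -
    have "(\<Sum>i\<le>k. (of_bool ((i, s div 2 ^ (k - i)) = K))\<^sup>2 :: real)
        = (\<Sum>i\<le>k. if i = j then of_bool (s div 2 ^ (k - j) = r) else 0)"
      by (intro sum.cong refl) (auto simp: jr)
    also have "\<dots> = of_bool (s div 2 ^ (k - j) = r)" using K by (simp add: jr)
    finally show ?thesis by (simp add: sqf_def L2_set_def)
  qed
  then have "sqf k (\<lambda>L. of_bool (L = K)) = (\<lambda>s. of_bool (s div 2 ^ (k - j) = r))"
    by (rule ext)
  then show "\<rho> k (sqf k (\<lambda>L. of_bool (L = K))) = len K powr \<theta>"
    using ind[of j k r] K by (simp add: jr len_def)
next
  fix j k :: nat and a :: "nat \<times> nat \<Rightarrow> real" assume j: "j \<le> k"
  have "(\<Sum>r<2^j. \<bar>a (j, r)\<bar>) / 2 ^ j = (\<Sum>s<2^k. \<bar>a (j, s div 2 ^ (k - j))\<bar>) / 2 ^ k"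
    using j unfolding sum_div_pow[OF j, of "\<lambda>r. \<bar>a (j, r)\<bar>"]
    by (simp add: power_diff)
  also have "\<dots> \<le> (\<Sum>s<2^k. sqf k a s) / 2 ^ k"
    unfolding sqf_def using j by (intro divide_right_mono sum_mono member_le_L2) auto
  also have "\<dots> \<le> \<rho> k (sqf k a)" by (intro mean_le) simp
  finally show "(\<Sum>r<2^j. \<bar>a (j, r)\<bar>) / 2 ^ j \<le> \<rho> k (sqf k a)" .
next
  fix j k :: nat assume j: "j \<le> k"
  have "sqf k (\<lambda>K. of_bool (fst K = j)) = (\<lambda>s. 1)"
  proof
    fix s
    have "(\<Sum>i\<le>k. (of_bool (i = j))\<^sup>2 :: real) = (\<Sum>i\<le>k. if i = j then 1 else 0)"
      by (intro sum.cong) auto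
    then show "sqf k (\<lambda>K. of_bool (fst K = j)) s = 1"
      using j by (simp add: sqf_def L2_set_def)
  qed
  then show "\<rho> k (sqf k (\<lambda>K. of_bool (fst K = j))) \<le> 1" by (simp add: one)
next
  fix m n and a :: "nat \<times> nat \<Rightarrow> real"
  have "sqf (m + n) (dil m a) s = sqf n a (s mod 2 ^ n)" for s
  proof -
    have "(\<Sum>l\<le>m + n. (dil m a (l, s div 2 ^ (m + n - l)))\<^sup>2)
        = (\<Sum>l=0+m..n+m. (dil m a (l, s div 2 ^ (m + n - l)))\<^sup>2)"
      by (intro sum.mono_neutral_right) (auto simp: dil_def)
    also have "\<dots> = (\<Sum>i\<le>n. (dil m a (i + m, s div 2 ^ (m + n - (i + m))))\<^sup>2)"
      by (subst sum.shift_bounds_cl_nat_ivl) (simp add: atLeast0AtMost)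
    also have "\<dots> = (\<Sum>i\<le>n. (a (i, s mod 2 ^ n div 2 ^ (n - i)))\<^sup>2)"
    proof (intro sum.cong refl)
      fix i assume "i \<in> {..n}"
      then have "(2::nat) ^ n = 2 ^ (n - i) * 2 ^ i" by (simp flip: power_add)
      \<comment> \<open>Passing to an ancestor commutes with taking the position relative to the
        level-m interval.\<close>
      then have "s mod 2 ^ n div 2 ^ (n - i) = s div 2 ^ (n - i) mod 2 ^ i"
        by (simp add: mod_mult2_eq)
      then show "(dil m a (i + m, s div 2 ^ (m + n - (i + m))))\<^sup>2 = (a (i, s mod 2 ^ n div 2 ^ (n - i)))\<^sup>2"
        by (simp add: dil_def base_def)
    qed
    finally show ?thesis by (simp add: sqf_def L2_set_def)
  qed
  then have "sqf (m + n) (dil m a) = (\<lambda>s. sqf n a (s mod 2 ^ n))" by (rule ext)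
  then show "\<rho> (m + n) (sqf (m + n) (dil m a)) \<le> \<rho> n (sqf n a)"
    using periodic[of "sqf n a" m n] by simp
next
  fix m n and b :: "nat \<times> nat \<Rightarrow> real"
  have "sqf n (avg m b) s \<le> (\<Sum>u<2^m. sqf (m + n) b (u * 2 ^ n + s)) / 2 ^ m" for s
  proof -
    define f where "f = (\<lambda>u i. b (m + i, (u * 2 ^ n + s) div 2 ^ (n - i)))"
    have "sqf n (avg m b) s = L2_set (\<lambda>i. (\<Sum>u<2^m. f u i) / 2 ^ m) {..n}"
      unfolding sqf_def
    proof (intro L2_set_cong refl)
      fix i assume "i \<in> {..n}"
      then have "(2::nat) ^ n = 2 ^ i * 2 ^ (n - i)" by (simp flip: power_add)
      then have "(u * 2 ^ n + s) div 2 ^ (n - i) = u * 2 ^ i + s div 2 ^ (n - i)" for u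
        by (simp add: mult.assoc[symmetric])
      then show "avg m b (i, s div 2 ^ (n - i)) = (\<Sum>u<2^m. f u i) / 2 ^ m"
        by (simp add: avg_def sum_fibre f_def copy_def)
    qed
    also have "\<dots> = L2_set (\<lambda>i. \<Sum>u<2^m. f u i) {..n} / 2 ^ m"
      using L2_set_right_distrib[of "1 / 2 ^ m" "\<lambda>i. \<Sum>u<2^m. f u i"] by simp
    also have "\<dots> \<le> (\<Sum>u<2^m. L2_set (f u) {..n}) / 2 ^ m"
      by (intro divide_right_mono L2_set_sum_le) simp
    also have "\<dots> \<le> (\<Sum>u<2^m. sqf (m + n) b (u * 2 ^ n + s)) / 2 ^ m"
    proof (intro divide_right_mono sum_mono)
      fix u
      let ?g = "\<lambda>l. (b (l, (u * 2 ^ n + s) div 2 ^ (m + n - l)))\<^sup>2"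
      \<comment> \<open>Shifted by m, these are the terms of levels m to m + n; the coarser levels
        only add squares.\<close>
      have "(\<Sum>i\<le>n. (f u i)\<^sup>2) = (\<Sum>l=0+m..n+m. ?g l)"
        by (subst sum.shift_bounds_cl_nat_ivl) (simp add: atLeast0AtMost f_def add.commute)
      also have "\<dots> \<le> (\<Sum>l\<le>m + n. ?g l)" by (intro sum_mono2) auto
      finally show "L2_set (f u) {..n} \<le> sqf (m + n) b (u * 2 ^ n + s)"
        by (simp add: sqf_def L2_set_def)
    qed simp
    finally show ?thesis .
  qed
  then have "\<rho> n (sqf n (avg m b)) \<le> \<rho> n (\<lambda>s. (\<Sum>u<2^m. sqf (m + n) b (u * 2 ^ n + s)) / 2 ^ m)"
    by (intro mono) auto
  also have "\<dots> \<le> \<rho> (m + n) (sqf (m + n) b)" by (intro average) simp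
  finally show "\<rho> n (sqf n (avg m b)) \<le> \<rho> (m + n) (sqf (m + n) b)" .
qed

end

section \<open>The maximum as a mean, for the SL norm\<close>

definition max_norm :: "nat \<Rightarrow> (nat \<Rightarrow> real) \<Rightarrow> real" where
  "max_norm k f = Max (f ` {..<2 ^ k})"

lemma max_norm_le_iff: "max_norm k f \<le> c \<longleftrightarrow> (\<forall>s<2^k. f s \<le> c)"
proof -
  have "{..<(2::nat) ^ k} \<noteq> {}" by (simp add: lessThan_empty_iff)
  then show ?thesis unfolding max_norm_def by (subst Max_le_iff) auto
qed

lemma max_norm_ge: "s < 2 ^ k \<Longrightarrow> f s \<le> max_norm k f"
  using max_norm_le_iff by blast

lemma mean_norm_max: "mean_norm max_norm 0"
proof
  fix k and f g :: "nat \<Rightarrow> real"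
  assume "\<And>s. s < 2 ^ k \<Longrightarrow> f s \<le> g s"
  then show "max_norm k f \<le> max_norm k g"
    unfolding max_norm_le_iff[of k f] using max_norm_ge order_trans by blast
next
  fix k and f g :: "nat \<Rightarrow> real"
  show "max_norm k (\<lambda>s. f s + g s) \<le> max_norm k f + max_norm k g"
    unfolding max_norm_le_iff by (auto intro!: add_mono max_norm_ge)
next
  fix k and c :: real and f :: "nat \<Rightarrow> real" assume "0 \<le> c"
  then have "mono (\<lambda>x. c * x)" by (auto intro!: monoI mult_left_mono)
  then have "c * Max (f ` {..<2 ^ k}) = Max ((\<lambda>x. c * x) ` f ` {..<2 ^ k})"
    by (intro mono_Max_commute) (auto simp: lessThan_empty_iff)
  then show "max_norm k (\<lambda>s. c * f s) = c * max_norm k f"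
    by (simp add: max_norm_def image_image)
next
  fix j k r :: nat assume jr: "j \<le> k" "r < 2 ^ j"
  have "r * 2 ^ (k - j) < 2 ^ j * 2 ^ (k - j)" using jr by simp
  then have s: "r * 2 ^ (k - j) < 2 ^ k" using jr by (simp flip: power_add)
  have "max_norm k (\<lambda>s. of_bool (s div 2 ^ (k - j) = r)) = 1"
    using max_norm_ge[OF s, of "\<lambda>s. of_bool (s div 2 ^ (k - j) = r)"]
    by (intro antisym) (auto simp: max_norm_le_iff)
  then show "max_norm k (\<lambda>s. of_bool (s div 2 ^ (k - j) = r)) = (1 / 2 ^ j) powr 0" by simp
next
  fix m n and f :: "nat \<Rightarrow> real"
  show "max_norm (m + n) (\<lambda>s. f (s mod 2 ^ n)) \<le> max_norm n f"
    unfolding max_norm_le_iff by (auto intro!: max_norm_ge)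
  show "max_norm n (\<lambda>s. (\<Sum>u<2^m. f (u * 2 ^ n + s)) / 2 ^ m) \<le> max_norm (m + n) f"
    unfolding max_norm_le_iff
  proof (intro allI impI)
    fix s :: nat assume s: "s < 2 ^ n"
    have "(\<Sum>u<2^m. f (u * 2 ^ n + s)) \<le> (\<Sum>u<(2::nat)^m. max_norm (m + n) f)"
    proof (intro sum_mono max_norm_ge)
      fix u :: nat assume "u \<in> {..<2 ^ m}"
      then have "u + 1 \<le> 2 ^ m" by simp
      then have "(u + 1) * 2 ^ n \<le> 2 ^ m * 2 ^ n" by (rule mult_right_mono) simp
      then show "u * 2 ^ n + s < 2 ^ (m + n)" using s by (simp add: power_add)
    qed
    then show "(\<Sum>u<2^m. f (u * 2 ^ n + s)) / 2 ^ m \<le> max_norm (m + n) f"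
      by (simp add: divide_le_eq mult.commute)
  qed
qed simp_all

section \<open>L^p means, for the Hardy norm\<close>

definition lp_norm :: "real \<Rightarrow> nat \<Rightarrow> (nat \<Rightarrow> real) \<Rightarrow> real" where
  "lp_norm p k f = ((\<Sum>s<2^k. f s powr p) / 2 ^ k) powr (1 / p)"

text \<open>Square functions may vanish, so zero has to be included; if one argument is zero, the
  claim reduces to \<open>c powr p \<le> c\<close> for c between 0 and 1.\<close>

lemma powr_convex_nonneg:
  assumes "1 \<le> p" shows "convex_on {0..} (\<lambda>x::real. x powr p)"
proof (rule convex_onI)
  fix t x y :: real assume t: "0 < t" "t < 1" and xy: "x \<in> {0..}" "y \<in> {0..}"
  have le: "(c * x) powr p \<le> c * x powr p" if "0 < c" "c < 1" "0 \<le> x" for c x :: real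
  proof -
    have "c powr p \<le> c powr 1" using that assms by (intro powr_mono') auto
    then show ?thesis using that by (simp add: powr_mult mult_right_mono)
  qed
  show "((1 - t) *\<^sub>R x + t *\<^sub>R y) powr p \<le> (1 - t) * x powr p + t * y powr p"
  proof (cases "x = 0 \<or> y = 0")
    case True
    then show ?thesis using le[of t y] le[of "1 - t" x] t xy assms by auto
  next
    case False
    then show ?thesis
      using convex_onD[OF powr_convex[OF assms], of t x y] t xy by auto
  qed
qed simp

lemma lp_norm_le_iff:
  assumes "1 \<le> p" "0 \<le> c"
  shows "lp_norm p k f \<le> c \<longleftrightarrow> (\<Sum>s<2^k. f s powr p) / 2 ^ k \<le> c powr p"
proof -
  let ?m = "(\<Sum>s<2^k. f s powr p) / 2 ^ k"
  have m: "0 \<le> ?m" by (simp add: sum_nonneg)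
  have c: "c = (c powr p) powr (1 / p)" using assms by (simp add: powr_powr)
  show ?thesis
  proof
    assume "lp_norm p k f \<le> c"
    then have "\<not> (c powr p) powr (1 / p) < ?m powr (1 / p)"
      using c by (simp add: lp_norm_def)
    then show "?m \<le> c powr p"
      using powr_less_mono2[of "1 / p" "c powr p" ?m] assms by (meson not_le powr_ge_zero
          zero_less_divide_1_iff less_le_trans zero_less_one)
  next
    assume "?m \<le> c powr p"
    then have "?m powr (1 / p) \<le> (c powr p) powr (1 / p)"
      using m assms by (intro powr_mono2) auto
    then show "lp_norm p k f \<le> c" using c by (simp add: lp_norm_def)
  qed
qed

lemma lp_norm_nonneg: "0 \<le> lp_norm p k f"
  by (simp add: lp_norm_def)

lemma lp_norm_powr:
  assumes "1 \<le> p"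
  shows "lp_norm p k f powr p = (\<Sum>s<2^k. f s powr p) / 2 ^ k"
  using assms by (simp add: lp_norm_def powr_powr sum_nonneg)

text \<open>Minkowski's inequality from convexity: (f + g) / (A + B) is the convex combination of f
  / A and g / B with weights A / (A + B) and B / (A + B). Positive bounds A and B stand in for the
  norms, which may vanish; \<open>mean_norm_lp\<close> lets them tend to the norms.\<close>

lemma lp_triangle_pos:
  assumes p: "1 \<le> p" and fg: "\<And>s. 0 \<le> f s" "\<And>s. 0 \<le> g s"
    and A: "0 < A" "lp_norm p k f \<le> A" and B: "0 < B" "lp_norm p k g \<le> B"
  shows "lp_norm p k (\<lambda>s. f s + g s) \<le> A + B"
proof -
  define t where "t = B / (A + B)"
  have t: "0 \<le> t" "t \<le> 1" and t': "1 - t = A / (A + B)"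
    using A B by (auto simp: t_def field_simps)
  have pt: "(f s + g s) powr p \<le> (A + B) powr p * ((1 - t) * (f s powr p / A powr p) + t * (g s powr p / B powr p))"
    for s
  proof -
    have "f s + g s = (A + B) * ((1 - t) *\<^sub>R (f s / A) + t *\<^sub>R (g s / B))"
    proof -
      have "(1 - t) *\<^sub>R (f s / A) = f s / (A + B)" "t *\<^sub>R (g s / B) = g s / (A + B)"
        unfolding t' using A B by (simp_all add: t_def)
      then show ?thesis using A B by (simp add: add_divide_distrib[symmetric])
    qed
    then have "(f s + g s) powr p = (A + B) powr p * ((1 - t) *\<^sub>R (f s / A) + t *\<^sub>R (g s / B)) powr p"
      using A B fg t by (simp add: powr_mult)
    also have "\<dots> \<le> (A + B) powr p * ((1 - t) * (f s / A) powr p + t * (g s / B) powr p)"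
      using A B fg t by (intro mult_left_mono convex_onD[OF powr_convex_nonneg[OF p]]) auto
    finally show ?thesis using A B fg by (simp add: powr_divide)
  qed
  have "(\<Sum>s<2^k. (f s + g s) powr p) / 2 ^ k
      \<le> (\<Sum>s<2^k. (A + B) powr p * ((1 - t) * (f s powr p / A powr p) + t * (g s powr p / B powr p))) / 2 ^ k"
    by (intro divide_right_mono sum_mono pt) simp
  also have "\<dots> = (A + B) powr p * ((1 - t) * ((\<Sum>s<2^k. f s powr p) / 2 ^ k / A powr p)
      + t * ((\<Sum>s<2^k. g s powr p) / 2 ^ k / B powr p))"
    using A B by (simp add: sum_distrib_left[symmetric] sum.distrib sum_divide_distrib[symmetric])
      (simp add: field_simps)
  also have "\<dots> \<le> (A + B) powr p * ((1 - t) * 1 + t * 1)"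
  proof (intro mult_left_mono add_mono)
    show "(\<Sum>s<2^k. f s powr p) / 2 ^ k / A powr p \<le> 1"
      using A lp_norm_le_iff[OF p, of A k f] by (simp add: divide_le_eq mult.commute)
    show "(\<Sum>s<2^k. g s powr p) / 2 ^ k / B powr p \<le> 1"
      using B lp_norm_le_iff[OF p, of B k g] by (simp add: divide_le_eq mult.commute)
  qed (use t in auto)
  finally show ?thesis using A B by (subst lp_norm_le_iff[OF p]) auto
qed

lemma mean_norm_lp:
  assumes p: "1 \<le> p"
  shows "mean_norm (lp_norm p) (1 / p)"
proof
  show "0 \<le> 1 / p" "1 / p \<le> 1" using p by auto
next
  fix k and f g :: "nat \<Rightarrow> real"
  assume fg: "\<And>s. s < 2 ^ k \<Longrightarrow> 0 \<le> f s" "\<And>s. s < 2 ^ k \<Longrightarrow> f s \<le> g s"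
  show "lp_norm p k f \<le> lp_norm p k g"
    unfolding lp_norm_def
  proof (intro powr_mono2 divide_right_mono sum_mono)
    show "0 \<le> (\<Sum>s<2^k. f s powr p) / 2 ^ k" by (simp add: sum_nonneg)
  qed (use p fg in auto)
next
  fix k and f g :: "nat \<Rightarrow> real"
  assume fg: "\<And>s. 0 \<le> f s" "\<And>s. 0 \<le> g s"
  show "lp_norm p k (\<lambda>s. f s + g s) \<le> lp_norm p k f + lp_norm p k g"
  proof (rule field_le_epsilon)
    fix e :: real assume e: "0 < e"
    have "lp_norm p k (\<lambda>s. f s + g s) \<le> (lp_norm p k f + e / 2) + (lp_norm p k g + e / 2)"
      using e lp_norm_nonneg[of p k f] lp_norm_nonneg[of p k g]
      by (intro lp_triangle_pos p fg) auto
    then show "lp_norm p k (\<lambda>s. f s + g s) \<le> lp_norm p k f + lp_norm p k g + e" by simp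
  qed
next
  fix k and c :: real and f :: "nat \<Rightarrow> real" assume f: "\<And>s. 0 \<le> f s" and c: "0 \<le> c"
  have "(\<Sum>s<2^k. (c * f s) powr p) / 2 ^ k = c powr p * ((\<Sum>s<2^k. f s powr p) / 2 ^ k)"
    using f c by (simp add: powr_mult sum_distrib_left)
  moreover have "(c powr p * ((\<Sum>s<2^k. f s powr p) / 2 ^ k)) powr (1 / p)
      = (c powr p) powr (1 / p) * ((\<Sum>s<2^k. f s powr p) / 2 ^ k) powr (1 / p)"
    by (rule powr_mult)
  ultimately show "lp_norm p k (\<lambda>s. c * f s) = c * lp_norm p k f"
    using c p by (simp add: lp_norm_def powr_powr)
next
  fix j k r :: nat assume jr: "j \<le> k" "r < 2 ^ j"
  have "(\<Sum>s<2^k. of_bool (s div 2 ^ (k - j) = r) powr p)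
      = (\<Sum>s<2^k. of_bool (s div 2 ^ (k - j) = r))"
    using p by (intro sum.cong refl) simp
  also have "\<dots> = 2 ^ (k - j) * (\<Sum>r'<2^j. of_bool (r' = r))"
    by (rule sum_div_pow[OF jr(1)])
  also have "\<dots> = 2 ^ k / 2 ^ j" using jr by (simp add: power_diff)
  finally show "lp_norm p k (\<lambda>s. of_bool (s div 2 ^ (k - j) = r)) = (1 / 2 ^ j) powr (1 / p)"
    by (simp add: lp_norm_def)
next
  fix m n and f :: "nat \<Rightarrow> real" assume f: "\<And>s. 0 \<le> f s"
  have "(\<Sum>s<2^(m+n). f (s mod 2 ^ n) powr p) = (\<Sum>u<2^m. \<Sum>v<2^n. f ((u * 2 ^ n + v) mod 2 ^ n) powr p)"
    by (rule sum_split_pow)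
  also have "\<dots> = 2 ^ m * (\<Sum>v<2^n. f v powr p)" by simp
  finally show "lp_norm p (m + n) (\<lambda>s. f (s mod 2 ^ n)) \<le> lp_norm p n f"
    by (simp add: lp_norm_def power_add)
  show "lp_norm p n (\<lambda>s. (\<Sum>u<2^m. f (u * 2 ^ n + s)) / 2 ^ m) \<le> lp_norm p (m + n) f"
  proof (subst lp_norm_le_iff[OF p lp_norm_nonneg])
    \<comment> \<open>Jensen's inequality with 2^m equal weights.\<close>
    have pt: "((\<Sum>u<2^m. f (u * 2 ^ n + s)) / 2 ^ m) powr p \<le> (\<Sum>u<2^m. f (u * 2 ^ n + s) powr p) / 2 ^ m" for s
    proof -
      have "(\<Sum>u<2^m. (1 / 2 ^ m) *\<^sub>R f (u * 2 ^ n + s)) powr p \<le> (\<Sum>u<(2::nat)^m. 1 / 2 ^ m * f (u * 2 ^ n + s) powr p)"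
        using f by (intro convex_on_sum[OF _ _ powr_convex_nonneg[OF p]]) (auto simp: lessThan_empty_iff)
      then show ?thesis by (simp add: sum_divide_distrib)
    qed
    have "(\<Sum>s<2^n. ((\<Sum>u<2^m. f (u * 2 ^ n + s)) / 2 ^ m) powr p) / 2 ^ n
        \<le> (\<Sum>s<2^n. (\<Sum>u<2^m. f (u * 2 ^ n + s) powr p) / 2 ^ m) / 2 ^ n"
      by (intro divide_right_mono sum_mono pt) simp
    also have "\<dots> = (\<Sum>s<2^n. \<Sum>u<2^m. f (u * 2 ^ n + s) powr p) / 2 ^ (m + n)"
      by (simp add: power_add sum_divide_distrib)
    also have "\<dots> = (\<Sum>s<2^(m+n). f s powr p) / 2 ^ (m + n)"
      by (subst sum_split_pow, subst sum.swap) simp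
    also have "\<dots> = lp_norm p (m + n) f powr p" by (simp add: lp_norm_powr[OF p])
    finally show "(\<Sum>s<2^n. ((\<Sum>u<2^m. f (u * 2 ^ n + s)) / 2 ^ m) powr p) / 2 ^ n
        \<le> lp_norm p (m + n) f powr p" .
  qed
qed

section \<open>Haar expansions as step functions\<close>

text \<open>\<open>Suc\<close> converts the zero-based position into the one-based numbering of
  \<open>dyadic\<close>, the form in which \<open>haar_interval\<close> applies.\<close>

definition iv :: "nat \<times> nat \<Rightarrow> real set" where
  "iv K = {(real (Suc (snd K)) - 1) / 2 ^ fst K ..< real (Suc (snd K)) / 2 ^ fst K}"

lemma iv_iff: "x \<in> iv (j, r) \<longleftrightarrow> \<lfloor>2 ^ j * x\<rfloor> = int r"
  by (auto simp: iv_def floor_eq_iff field_simps)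

lemma measure_iv [simp]: "emeasure lebesgue (iv K) = ennreal (len K)" "measure lebesgue (iv K) = len K"
  "iv K \<in> lmeasurable" "iv K \<in> sets lebesgue"
proof -
  have "(real (Suc (snd K)) - 1) / 2 ^ fst K \<le> real (Suc (snd K)) / 2 ^ fst K"
    by (simp add: divide_right_mono)
  then show "emeasure lebesgue (iv K) = ennreal (len K)" "measure lebesgue (iv K) = len K"
    by (simp_all add: iv_def len_def diff_divide_distrib[symmetric])
  show "iv K \<in> sets lebesgue" by (simp add: iv_def)
  with \<open>emeasure lebesgue (iv K) = ennreal (len K)\<close> show "iv K \<in> lmeasurable"
    by (intro fmeasurableI) auto
qed

lemma haar_iv: "haar (iv (j, r)) x =
    (if \<lfloor>2 ^ j * x\<rfloor> = int r then if even \<lfloor>2 ^ Suc j * x\<rfloor> then 1 else -1 else 0)"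
  unfolding iv_def fst_conv snd_conv haar_interval by simp

lemma inj_iv: "inj iv"
proof (rule injI)
  fix K L assume eq: "iv K = iv L"
  have "len K = len L" using eq measure_iv(2) by metis
  then have f: "fst K = fst L" by (simp add: len_def)
  have "real (snd K) / 2 ^ fst K \<in> iv (fst K, snd K)" unfolding iv_iff by simp
  then have "real (snd K) / 2 ^ fst K \<in> iv (fst L, snd L)" using eq by simp
  then have "snd K = snd L" unfolding iv_iff f by simp
  with f show "K = L" by (rule prod_eqI)
qed

lemma iv_image: "iv ` idx k = dyadic_upto k"
proof -
  have "dyadic_upto k = (\<lambda>(m, l). {(real l - 1) / 2 ^ m ..< real l / 2 ^ m}) ` (\<lambda>(m, r). (m, Suc r)) ` idx k"
    unfolding dyadic_upto_eq
  proof (rule arg_cong[where f = "image _"], intro set_eqI iffI)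
    fix K assume "K \<in> (SIGMA m:{..k}. {1..(2::nat) ^ m})"
    then obtain m l where "K = (m, l)" "m \<le> k" "1 \<le> l" "l \<le> 2 ^ m" by auto
    then have "K = (\<lambda>(m, r). (m, Suc r)) (m, l - 1)" "(m, l - 1) \<in> idx k" by auto
    then show "K \<in> (\<lambda>(m, r). (m, Suc r)) ` idx k" by blast
  qed auto
  then show ?thesis by (simp add: image_image iv_def split_def)
qed

definition syn :: "nat \<Rightarrow> (nat \<times> nat \<Rightarrow> real) \<Rightarrow> real \<Rightarrow> real" where
  "syn k a x = (\<Sum>K\<in>idx k. a K * haar (iv K) x)"

definition cf :: "nat \<Rightarrow> (real \<Rightarrow> real) \<Rightarrow> nat \<times> nat \<Rightarrow> real" where
  "cf k f K = (if K \<in> idx k then haar_coeffs f (iv K) else 0)"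

lemma haar_span_eq: "haar_span k = range (syn k)"
proof -
  have re: "(\<Sum>I\<in>dyadic_upto k. a I * haar I x) = syn k (\<lambda>K. a (iv K)) x" for a x
    unfolding syn_def iv_image[symmetric]
    by (subst sum.reindex) (auto intro: inj_on_subset[OF inj_iv])
  show ?thesis
  proof (intro set_eqI iffI)
    fix f assume "f \<in> haar_span k"
    then show "f \<in> range (syn k)" unfolding haar_span_def re by auto
  next
    fix f assume "f \<in> range (syn k)"
    then obtain a where "f = syn k a" by auto
    then have "f = (\<lambda>x. syn k (\<lambda>K. (a \<circ> inv iv) (iv K)) x)" by (simp add: inv_f_f[OF inj_iv])
    then show "f \<in> haar_span k" unfolding haar_span_def re by blast
  qed
qed

lemma syn_in [simp]: "syn k a \<in> haar_span k"
  by (simp add: haar_span_eq)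

lemma haar_coeffs_syn:
  "haar_coeffs (syn k a) = (\<lambda>I. if I \<in> dyadic_upto k then a (inv iv I) else 0)"
proof -
  have "syn k a = (\<lambda>x. \<Sum>I\<in>dyadic_upto k. (if I \<in> dyadic_upto k then a (inv iv I) else 0) * haar I x)"
    unfolding iv_image[symmetric]
    by (subst sum.reindex) (auto simp: fun_eq_iff syn_def inv_f_f[OF inj_iv] intro: inj_on_subset[OF inj_iv])
  moreover have "dyadic_upto k \<subseteq> dyadic"
    by (auto simp: dyadic_upto_def dyadic_level_def)
  ultimately show ?thesis
    using haar_coeffs_sum[OF finite_dyadic_upto, of k "\<lambda>I. if I \<in> dyadic_upto k then a (inv iv I) else 0"]
    by simp
qed

lemma cf_syn: "cf k (syn k a) = (\<lambda>K. if K \<in> idx k then a K else 0)"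
  unfolding cf_def haar_coeffs_syn iv_image[symmetric]
  by (auto simp: fun_eq_iff inv_f_f[OF inj_iv])

lemma syn_cong: "(\<And>K. K \<in> idx k \<Longrightarrow> a K = b K) \<Longrightarrow> syn k a = syn k b"
  by (auto simp: fun_eq_iff syn_def intro!: sum.cong)

lemma syn_cf: "f \<in> haar_span k \<Longrightarrow> syn k (cf k f) = f"
  unfolding haar_span_eq by (auto simp: cf_syn intro: syn_cong)

lemma syn_add: "syn k (\<lambda>K. a K + b K) = (\<lambda>x. syn k a x + syn k b x)"
  by (simp add: fun_eq_iff syn_def distrib_right sum.distrib)

lemma syn_mult: "syn k (\<lambda>K. c * a K) = (\<lambda>x. c * syn k a x)"
  by (simp add: fun_eq_iff syn_def sum_distrib_left mult.assoc)

lemma syn_sum: "syn k (\<lambda>K. \<Sum>i\<in>S. f i K) = (\<lambda>x. \<Sum>i\<in>S. syn k (f i) x)"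
  unfolding syn_def fun_eq_iff sum_distrib_right by (auto intro: sum.swap)

lemma syn_unit: "K \<in> idx k \<Longrightarrow> syn k (\<lambda>L. of_bool (L = K)) = haar (iv K)"
  by (simp add: fun_eq_iff syn_def)

lemma cf_add:
  assumes "f \<in> haar_span k" "g \<in> haar_span k"
  shows "cf k (\<lambda>x. f x + g x) = (\<lambda>K. cf k f K + cf k g K)"
proof -
  obtain a b where "f = syn k a" "g = syn k b" using assms by (auto simp: haar_span_eq)
  then show ?thesis by (auto simp: syn_add[symmetric] cf_syn)
qed

lemma cf_mult:
  assumes "f \<in> haar_span k"
  shows "cf k (\<lambda>x. c * f x) = (\<lambda>K. c * cf k f K)"
proof -
  obtain a where "f = syn k a" using assms by (auto simp: haar_span_eq)
  then show ?thesis by (auto simp: syn_mult[symmetric] cf_syn)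
qed


section \<open>Step functions on the dyadic grid\<close>

lemma floor_pow_nat:
  fixes x :: real
  assumes "0 \<le> x" "x < 1" "j \<le> k"
  shows "\<lfloor>2 ^ j * x\<rfloor> = int (nat \<lfloor>2 ^ k * x\<rfloor> div 2 ^ (k - j))" "nat \<lfloor>2 ^ k * x\<rfloor> < 2 ^ k"
proof -
  have "0 \<le> \<lfloor>2 ^ k * x\<rfloor>" using assms by simp
  then show "\<lfloor>2 ^ j * x\<rfloor> = int (nat \<lfloor>2 ^ k * x\<rfloor> div 2 ^ (k - j))"
    unfolding floor_pow2_div[OF assms(3)] by (simp add: zdiv_int)
  have "2 ^ k * x < 2 ^ k" using assms by simp
  then have "\<lfloor>2 ^ k * x\<rfloor> < 2 ^ k" by (simp add: floor_less_iff)
  then show "nat \<lfloor>2 ^ k * x\<rfloor> < 2 ^ k" by (simp add: nat_less_iff)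
qed

text \<open>Used mostly in contrapositive form: a point off the half-open unit interval lies in no
  dyadic interval.\<close>

lemma floor_pow_outside:
  fixes x :: real
  assumes "r < 2 ^ j" "\<lfloor>2 ^ j * x\<rfloor> = int r"
  shows "0 \<le> x" "x < 1"
proof -
  have "real r \<le> 2 ^ j * x" "2 ^ j * x < real r + 1" using assms(2) by (auto simp: floor_eq_iff)
  moreover have "real r + 1 \<le> 2 ^ j"
    using assms(1) by (metis Suc_leI of_nat_Suc of_nat_le_iff of_nat_numeral of_nat_power add.commute)
  ultimately have ge: "0 \<le> 2 ^ j * x" and less: "2 ^ j * x < 2 ^ j * 1" by linarith+
  show "0 \<le> x" using ge mult_le_cancel_left_pos[of "2 ^ j" 0 x] by simp
  show "x < 1"
    using less by (simp only: mult_less_cancel_left_pos zero_less_power zero_less_numeral)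
qed

lemma step_function:
  fixes x :: real
  shows "(if 0 \<le> x \<and> x < 1 then c (nat \<lfloor>2 ^ k * x\<rfloor>) else 0) = (\<Sum>s<2^k. c s * indicator (iv (k, s)) x :: real)"
proof (cases "0 \<le> x \<and> x < 1")
  case True
  then have "0 \<le> \<lfloor>2 ^ k * x\<rfloor>" by simp
  then have "(\<Sum>s<2^k. c s * indicator (iv (k, s)) x) = (\<Sum>s<2^k. if s = nat \<lfloor>2 ^ k * x\<rfloor> then c s else 0)"
    by (intro sum.cong) (auto simp: indicator_def iv_iff)
  then show ?thesis using True floor_pow_nat(2)[of x k k] by simp
next
  case False
  have "x \<notin> iv (k, s)" if "s < 2 ^ k" for s
    using floor_pow_outside[OF that, of x] False by (auto simp: iv_iff)
  then have "(\<Sum>s<2^k. c s * indicator (iv (k, s)) x) = (\<Sum>s<(2::nat)^k. 0)"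
    by (intro sum.cong) auto
  also have "\<dots> = 0" by simp
  finally show ?thesis using False by (simp only: if_False)
qed

text \<open>The integral is over the closed interval, but f vanishes at 1, so the half-open cells
  account for all of it.\<close>

lemma integral_step:
  fixes c :: "nat \<Rightarrow> real" and f :: "real \<Rightarrow> real"
  assumes "\<And>x. f x = (if 0 \<le> x \<and> x < 1 then c (nat \<lfloor>2 ^ k * x\<rfloor>) else 0)"
  shows "(LINT x:{0..1}|lebesgue. f x) = (\<Sum>s<2^k. c s) / 2 ^ k"
proof -
  have "(LINT x:{0..1}|lebesgue. f x) = (LINT x|lebesgue. (\<Sum>s<2^k. c s * indicator (iv (k, s)) x))"
    unfolding set_lebesgue_integral_def step_function[symmetric]
    by (rule Bochner_Integration.integral_cong) (auto simp: assms)
  also have "\<dots> = (\<Sum>s<2^k. LINT x|lebesgue. c s * indicator (iv (k, s)) x)"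
    by (intro Bochner_Integration.integral_sum integrable_mult_right) (simp add: fmeasurableD2)
  also have "\<dots> = (\<Sum>s<2^k. c s / 2 ^ k)"
    by (intro sum.cong refl) (simp add: len_def)
  finally show ?thesis by (simp add: sum_divide_distrib)
qed

lemma sq_sum_syn:
  "sq_sum (syn k a) x = (if 0 \<le> x \<and> x < 1 then (sqf k a (nat \<lfloor>2 ^ k * x\<rfloor>))\<^sup>2 else 0)"
proof -
  have "sq_sum (syn k a) x = (\<Sum>I\<in>dyadic_upto k. (haar_coeffs (syn k a) I)\<^sup>2 * (haar I x)\<^sup>2)"
    unfolding sq_sum_def by (intro sum.mono_neutral_left) (auto simp: haar_coeffs_syn finite_dyadic_upto)
  also have "\<dots> = (\<Sum>K\<in>idx k. (a K)\<^sup>2 * (haar (iv K) x)\<^sup>2)"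
    unfolding haar_coeffs_syn iv_image[symmetric]
    by (subst sum.reindex) (auto simp: inv_f_f[OF inj_iv] intro: inj_on_subset[OF inj_iv])
  also have "\<dots> = (\<Sum>j\<le>k. \<Sum>r<2^j. if \<lfloor>2 ^ j * x\<rfloor> = int r then (a (j, r))\<^sup>2 else 0)"
    unfolding sum_idx by (intro sum.cong refl) (auto simp: haar_iv)
  also have "\<dots> = (if 0 \<le> x \<and> x < 1 then (sqf k a (nat \<lfloor>2 ^ k * x\<rfloor>))\<^sup>2 else 0)"
  proof (cases "0 \<le> x \<and> x < 1")
    case True
    let ?s = "nat \<lfloor>2 ^ k * x\<rfloor>"
    have "(\<Sum>r<2^j. if \<lfloor>2 ^ j * x\<rfloor> = int r then (a (j, r))\<^sup>2 else 0) = (a (j, ?s div 2 ^ (k - j)))\<^sup>2"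
      if "j \<le> k" for j
      using that True floor_pow_nat[of x j k] div_pow_less[of ?s k j] by simp
    then show ?thesis using True by (simp add: sqf_def L2_set_def sum_nonneg)
  next
    case False
    then have "\<lfloor>2 ^ j * x\<rfloor> \<noteq> int r" if "r < 2 ^ j" for j r
      using floor_pow_outside[OF that] by blast
    then have "(\<Sum>r<2^j. if \<lfloor>2 ^ j * x\<rfloor> = int r then (a (j, r))\<^sup>2 else 0) = 0" for j
      by (intro sum.neutral) auto
    then have "(\<Sum>j\<le>k. \<Sum>r<2 ^ j. if \<lfloor>2 ^ j * x\<rfloor> = int r then (a (j, r))\<^sup>2 else 0) = 0" by simp
    then show ?thesis using False by (simp only: if_False)
  qed
  finally show ?thesis .
qed

lemma hardy_norm_syn:
  assumes "1 \<le> p"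
  shows "hardy_norm p (syn k a) = lp_norm p k (sqf k a)"
proof -
  have e: "(G\<^sup>2) powr (p / 2) = G powr p" if "0 \<le> G" for G :: real
    using that assms by (cases "G = 0") (simp_all add: powr_powr flip: powr_numeral)
  have "(LINT x:{0..1}|lebesgue. sq_sum (syn k a) x powr (p / 2)) = (\<Sum>s<2^k. sqf k a s powr p) / 2 ^ k"
    using assms by (intro integral_step) (simp add: sq_sum_syn e)
  then show ?thesis by (simp add: hardy_norm_def lp_norm_def)
qed

text \<open>The square function is constant on each cell, and cells have positive measure, so no
  null set can hide the largest value.\<close>

lemma sl_norm_syn: "sl_norm (syn k a) = max_norm k (sqf k a)"
proof -
  define F where "F = (\<lambda>x. ereal (sqrt (sq_sum (syn k a) x)))"
  have F: "F = (\<lambda>x. ereal (\<Sum>s<2^k. sqf k a s * indicator (iv (k, s)) x))"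
    unfolding F_def step_function[symmetric] sq_sum_syn by (auto simp: fun_eq_iff)
  have "F \<in> borel_measurable lebesgue"
    unfolding F by (intro borel_measurable_ereal borel_measurable_sum borel_measurable_times
        borel_measurable_indicator) auto
  then have meas: "F \<in> borel_measurable (lebesgue_on {0..1})" by (rule measurable_restrict_space1)
  have F_le: "F x \<le> ereal (max_norm k (sqf k a))" for x
    using floor_pow_nat(2)[of x k k] max_norm_ge[of "nat \<lfloor>2 ^ k * x\<rfloor>" k "sqf k a"]
      max_norm_ge[of 0 k "sqf k a"] order_trans[OF sqf_nonneg[of k a 0]]
    unfolding F_def sq_sum_syn by auto
  have ge: "ereal (sqf k a s) \<le> esssup (lebesgue_on {0..1}) F" if s: "s < 2 ^ k" for s
  proof (rule ccontr)
    assume less: "\<not> ?thesis"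
    have sub: "x \<in> {0..1} \<and> F x = ereal (sqf k a s)" if "x \<in> iv (k, s)" for x
      using floor_pow_outside[OF s, of x] that unfolding iv_iff F_def sq_sum_syn by auto
    have "AE x in lebesgue_on {0..1}. F x \<le> esssup (lebesgue_on {0..1}) F" by (rule esssup_AE)
    then have "AE x in lebesgue. x \<in> {0..1} \<longrightarrow> F x \<le> esssup (lebesgue_on {0..1}) F"
      by (subst (asm) AE_restrict_space_iff) auto
    then have "AE x in lebesgue. x \<notin> iv (k, s)"
      by eventually_elim (use sub less in auto)
    then have "iv (k, s) \<in> null_sets lebesgue" by (subst (asm) AE_iff_null_sets[symmetric]) auto
    then have "len (k, s) \<le> 0" by (simp add: null_sets_def ennreal_eq_0_iff)
    then show False using len_pos(1)[of "(k, s)"] by linarith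
  qed
  have "esssup (lebesgue_on {0..1}) F = ereal (max_norm k (sqf k a))"
  proof (rule antisym)
    show "esssup (lebesgue_on {0..1}) F \<le> ereal (max_norm k (sqf k a))"
      using meas F_le by (intro esssup_I) auto
    have "max_norm k (sqf k a) \<in> sqf k a ` {..<2 ^ k}"
      unfolding max_norm_def by (intro Max_in) (auto simp: lessThan_empty_iff)
    then show "ereal (max_norm k (sqf k a)) \<le> esssup (lebesgue_on {0..1}) F" using ge by auto
  qed
  then show ?thesis by (simp add: sl_norm_def F_def)
qed

section \<open>Orthogonality of the Haar functions\<close>

definition grid_haar :: "nat \<Rightarrow> nat \<times> nat \<Rightarrow> nat \<Rightarrow> real" where
  "grid_haar k K s = of_bool (s div 2 ^ Suc (k - fst K) = snd K) * (if even (s div 2 ^ (k - fst K)) then 1 else -1)"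

text \<open>A Haar function of level at most k is constant on the cells of level k + 1, hence the
  \<open>Suc\<close>. The ancestor at the level of K decides whether a cell lies in the interval,
  and the parity of the ancestor one level finer decides in which half.\<close>

lemma haar_grid:
  assumes "K \<in> idx k"
  shows "haar (iv K) x = (if 0 \<le> x \<and> x < 1 then grid_haar k K (nat \<lfloor>2 ^ Suc k * x\<rfloor>) else 0)"
proof -
  obtain j r where K: "K = (j, r)" by force
  show ?thesis
  proof (cases "0 \<le> x \<and> x < 1")
    case True
    then have "\<lfloor>2 ^ j * x\<rfloor> = int (nat \<lfloor>2 ^ Suc k * x\<rfloor> div 2 ^ (Suc k - j))"
      "\<lfloor>2 ^ Suc j * x\<rfloor> = int (nat \<lfloor>2 ^ Suc k * x\<rfloor> div 2 ^ (Suc k - Suc j))"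
      using assms by (simp_all only: K idx_iff floor_pow_nat(1)[of x j "Suc k"]
          floor_pow_nat(1)[of x "Suc j" "Suc k"] le_SucI Suc_le_mono)
    moreover have "Suc k - j = Suc (k - j)" using assms by (simp add: K Suc_diff_le)
    ultimately show ?thesis using True unfolding K haar_iv grid_haar_def by simp
  next
    case False
    then have "\<lfloor>2 ^ j * x\<rfloor> \<noteq> int r" using floor_pow_outside assms K by auto
    then show ?thesis using False unfolding K haar_iv by auto
  qed
qed

text \<open>A function constant on the intervals of level j cancels against the opposite signs on
  the two halves of each.\<close>

lemma grid_mean_zero:
  fixes g :: "nat \<Rightarrow> real"
  assumes "j \<le> k"
  shows "(\<Sum>s<2 ^ Suc k. g (s div 2 ^ Suc (k - j)) * (if even (s div 2 ^ (k - j)) then 1 else -1)) = 0"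
proof -
  define l where "l = k - j"
  have k: "Suc k = j + Suc l" "Suc l = 1 + l" using assms by (auto simp: l_def)
  have "(\<Sum>s<2 ^ Suc k. g (s div 2 ^ Suc l) * (if even (s div 2 ^ l) then 1 else -1))
      = (\<Sum>u<2 ^ j. \<Sum>v<2 ^ Suc l. g ((u * 2 ^ Suc l + v) div 2 ^ Suc l) *
          (if even ((u * 2 ^ Suc l + v) div 2 ^ l) then 1 else -1))"
    unfolding k(1) by (rule sum_split_pow)
  also have "\<dots> = (\<Sum>u<2 ^ j. \<Sum>v<(2::nat) ^ Suc l. g u * (if even (v div 2 ^ l) then 1 else -1))"
  proof (intro sum.cong refl)
    fix u v :: nat assume v: "v \<in> {..<2 ^ Suc l}"
    have "u * 2 ^ Suc l + v = (2 * u) * 2 ^ l + v" by simp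
    then have "(u * 2 ^ Suc l + v) div 2 ^ l = 2 * u + v div 2 ^ l"
      by (simp only: div_mult_self3 power_not_zero) simp
    then have "even ((u * 2 ^ Suc l + v) div 2 ^ l) \<longleftrightarrow> even (v div 2 ^ l)" by simp
    moreover have "(u * 2 ^ Suc l + v) div 2 ^ Suc l = u" using v by simp
    ultimately show "g ((u * 2 ^ Suc l + v) div 2 ^ Suc l) *
        (if even ((u * 2 ^ Suc l + v) div 2 ^ l) then 1 else -1)
        = g u * (if even (v div 2 ^ l) then 1 else -1)" by simp
  qed
  also have "\<dots> = (\<Sum>u<2 ^ j. g u * (\<Sum>w<(2::nat) ^ 1. \<Sum>v<(2::nat) ^ l. if even ((w * 2 ^ l + v) div 2 ^ l) then 1 else -1))"
    unfolding k(2) sum_split_pow sum_distrib_left by simp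
  also have "\<dots> = 0" by (simp add: numeral_2_eq_2)
  finally show ?thesis by (simp add: l_def)
qed

text \<open>The coarser Haar function is constant on the support of the finer one, so the product is
  a multiple of a Haar function.\<close>

lemma grid_orthogonal_less:
  assumes "fst K < fst L" "L \<in> idx k"
  shows "(\<Sum>s<2 ^ Suc k. grid_haar k K s * grid_haar k L s) = 0"
proof -
  define i j where "i = fst K" and "j = fst L"
  have ij: "i < j" "j \<le> k" using assms by (cases L; auto simp: i_def j_def)+
  \<comment> \<open>The coarser function, cut off to L, in terms of the position \<open>u\<close> at
    level j. Its sign is decided at level i + 1, which is at most j.\<close>
  define g where "g = (\<lambda>u. of_bool (u div 2 ^ (j - i) = snd K)
      * (if even (u div 2 ^ (j - i - 1)) then 1 else -1) * of_bool (u = snd L) :: real)"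
  have "k - i = Suc (k - j) + (j - i - 1)" "Suc (k - i) = Suc (k - j) + (j - i)" using ij by auto
  then have "s div 2 ^ (k - i) = s div 2 ^ Suc (k - j) div 2 ^ (j - i - 1)"
    "s div 2 ^ Suc (k - i) = s div 2 ^ Suc (k - j) div 2 ^ (j - i)" for s :: nat
    by (simp_all only: power_add div_mult2_eq)
  then have "grid_haar k K s * grid_haar k L s
      = g (s div 2 ^ Suc (k - j)) * (if even (s div 2 ^ (k - j)) then 1 else -1)" for s
    unfolding grid_haar_def i_def[symmetric] j_def[symmetric] g_def by (simp only: mult_ac)
  then show ?thesis using grid_mean_zero[OF ij(2), of g] by simp
qed

lemma grid_orthogonal:
  assumes K: "K \<in> idx k" and L: "L \<in> idx k"
  shows "(\<Sum>s<2 ^ Suc k. grid_haar k K s * grid_haar k L s) = of_bool (K = L) * (len K * 2 ^ Suc k)"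
proof -
  consider "fst K < fst L" | "fst L < fst K" | "fst K = fst L" by linarith
  then show ?thesis
  proof cases
    case 1
    then show ?thesis using grid_orthogonal_less[OF 1 L] by auto
  next
    case 2
    then show ?thesis using grid_orthogonal_less[OF 2 K] by (auto simp: mult.commute)
  next
    case 3
    obtain j r where jr: "K = (j, r)" "j \<le> k" "r < 2 ^ j" using K by (cases K) auto
    have "(\<Sum>s<2 ^ Suc k. grid_haar k K s * grid_haar k L s)
        = (\<Sum>s<2 ^ Suc k. of_bool (s div 2 ^ (Suc k - j) = r) * of_bool (K = L))"
      using 3 jr by (intro sum.cong refl) (auto simp: grid_haar_def Suc_diff_le prod_eq_iff)
    also have "\<dots> = 2 ^ (Suc k - j) * of_bool (K = L)"
      using jr sum_div_pow[of j "Suc k" "\<lambda>u. of_bool (u = r) * of_bool (K = L)"]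
      by (simp add: sum_distrib_right[symmetric])
    also have "\<dots> = of_bool (K = L) * (len K * 2 ^ Suc k)"
      using jr by (simp add: len_def power_diff del: power_Suc)
    finally show ?thesis .
  qed
qed

lemma pairing_syn: "pairing (syn k a) (syn k b) = pair k a b"
proof -
  define A where "A = (\<lambda>a s. \<Sum>K\<in>idx k. a K * grid_haar k K s)"
  have "syn k a x = (if 0 \<le> x \<and> x < 1 then A a (nat \<lfloor>2 ^ Suc k * x\<rfloor>) else 0)" for a x
    unfolding syn_def A_def by (auto simp: haar_grid intro!: sum.cong)
  then have "pairing (syn k a) (syn k b) = (\<Sum>s<2 ^ Suc k. A a s * A b s) / 2 ^ Suc k"
    unfolding pairing_def by (intro integral_step) simp
  also have "(\<Sum>s<2 ^ Suc k. A a s * A b s)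
      = (\<Sum>s<2 ^ Suc k. \<Sum>K\<in>idx k. \<Sum>L\<in>idx k. a K * b L * (grid_haar k K s * grid_haar k L s))"
    unfolding A_def sum_product by (simp only: mult_ac)
  also have "\<dots> = (\<Sum>K\<in>idx k. \<Sum>s<2 ^ Suc k. \<Sum>L\<in>idx k. a K * b L * (grid_haar k K s * grid_haar k L s))"
    by (rule sum.swap)
  also have "\<dots> = (\<Sum>K\<in>idx k. \<Sum>L\<in>idx k. \<Sum>s<2 ^ Suc k. a K * b L * (grid_haar k K s * grid_haar k L s))"
    by (rule sum.cong[OF refl], rule sum.swap)
  also have "\<dots> = (\<Sum>K\<in>idx k. \<Sum>L\<in>idx k. if K = L then a K * b K * (len K * 2 ^ Suc k) else 0)"
    unfolding sum_distrib_left[symmetric] by (intro sum.cong refl) (simp add: grid_orthogonal del: power_Suc)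
  also have "\<dots> = pair k a b * 2 ^ Suc k"
    by (simp add: pair_def sum_distrib_left sum_distrib_right mult_ac del: power_Suc)
  finally show ?thesis by simp
qed

lemma hardy_dual_norm_syn:
  assumes "1 \<le> p"
  shows "hardy_dual_norm p k (syn k a) = dual (\<lambda>k a. lp_norm p k (sqf k a)) k a"
proof -
  have "{g \<in> haar_span k. hardy_norm p g \<le> 1} = syn k ` {b. lp_norm p k (sqf k b) \<le> 1}"
    using hardy_norm_syn[OF assms] by (auto simp: haar_span_eq)
  then show ?thesis by (simp add: hardy_dual_norm_def dual_def image_image pairing_syn)
qed

section \<open>Factorization of operators\<close>

lemma linear_between_syn:
  assumes E: "coeff_linear E"
  shows "linear_between (haar_span n) (haar_span k) (\<lambda>f. syn k (E (cf n f)))"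
  using E unfolding linear_between_def coeff_linear_def
  by (simp add: cf_add cf_mult syn_add syn_mult)

text \<open>\<open>linear_between\<close> speaks only of sums of two elements of the span, so the
  expansion is reached by induction over subsets of \<open>idx k\<close>, carrying membership in the
  span along.\<close>

lemma linear_between_expand:
  assumes T: "linear_between (haar_span k) (haar_span k) T"
  shows "T (syn k a) = syn k (\<lambda>L. \<Sum>K\<in>idx k. a K * cf k (T (haar (iv K))) L)"
proof -
  have mem: "haar (iv K) \<in> haar_span k" if "K \<in> idx k" for K
    using syn_in[of k "\<lambda>L. of_bool (L = K)"] syn_unit[OF that] by simp
  have sum_mem: "(\<lambda>x. \<Sum>K\<in>S. a K * haar (iv K) x) \<in> haar_span k" if "S \<subseteq> idx k" for S
  proof -
    have "(\<lambda>x. \<Sum>K\<in>S. a K * haar (iv K) x) = syn k (\<lambda>K. of_bool (K \<in> S) * a K)"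
      unfolding syn_def using that by (intro ext sum.mono_neutral_cong_left) auto
    then show ?thesis by simp
  qed
  have add: "T (\<lambda>x. f x + g x) = (\<lambda>x. T f x + T g x)" if "f \<in> haar_span k" "g \<in> haar_span k" for f g
    using T that unfolding linear_between_def by blast
  have mult: "T (\<lambda>x. c * f x) = (\<lambda>x. c * T f x)" if "f \<in> haar_span k" for c f
    using T that unfolding linear_between_def by blast
  have "T (\<lambda>x. \<Sum>K\<in>S. a K * haar (iv K) x) = (\<lambda>x. \<Sum>K\<in>S. a K * T (haar (iv K)) x)"
    if "S \<subseteq> idx k" for S
    using finite_subset[OF that finite_idx] that
  proof (induction S rule: finite_induct)
    case empty
    \<comment> \<open>The empty sum: T maps zero to zero, as scaling an element of the span by 0
      shows.\<close>
    show ?case using mult[OF syn_in[of k a], of 0] by simp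
  next
    case (insert K S)
    then have K: "K \<in> idx k" and S: "S \<subseteq> idx k" by auto
    have "(\<lambda>x. a K * haar (iv K) x) \<in> haar_span k" using sum_mem[of "{K}"] K by simp
    from add[OF this sum_mem[OF S]] mult[OF mem[OF K], of "a K"]
    show ?case using insert.hyps insert.IH[OF S] by simp
  qed
  from this[of "idx k"] have "T (syn k a) = (\<lambda>x. \<Sum>K\<in>idx k. a K * T (haar (iv K)) x)"
    unfolding syn_def[abs_def] by simp
  also have "\<dots> = (\<lambda>x. \<Sum>K\<in>idx k. syn k (\<lambda>L. a K * cf k (T (haar (iv K))) L) x)"
    using T mem unfolding linear_between_def syn_mult by (auto simp: syn_cf intro!: sum.cong)
  finally show ?thesis by (simp only: syn_sum)
qed

context haar_norm
begin

text \<open>The crude constant C, from the images of finitely many Haar functions, shows that the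
  supremum is over a bounded set and also settles families of norm zero; all others are
  normalised.\<close>

lemma op_norm_bound:
  assumes normW: "\<And>k a. normW k (syn k a) = \<nu> k a"
    and T: "linear_between (haar_span k) (haar_span k) T"
    and \<Gamma>: "op_norm (haar_span k) (normW k) (normW k) T \<le> \<Gamma>"
  shows "\<nu> k (\<lambda>L. \<Sum>K\<in>idx k. a K * cf k (T (haar (iv K))) L) \<le> \<Gamma> * \<nu> k a"
proof -
  define \<tau> where "\<tau> = (\<lambda>K L. cf k (T (haar (iv K))) L)"
  define A where "A = (\<lambda>a L. \<Sum>K\<in>idx k. a K * \<tau> K L)"
  have TA: "normW k (T (syn k a)) = \<nu> k (A a)" for a
    unfolding linear_between_expand[OF T] normW A_def \<tau>_def ..
  define C where "C = (\<Sum>K\<in>idx k. \<nu> k (\<tau> K) / len K powr \<theta>)"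
  have le: "\<nu> k (A a) \<le> C * \<nu> k a" for a
  proof -
    have "\<nu> k (A a) \<le> (\<Sum>K\<in>idx k. \<nu> k (\<lambda>L. a K * \<tau> K L))"
      unfolding A_def by (rule triangle_sum)
    also have "\<dots> \<le> (\<Sum>K\<in>idx k. \<nu> k (\<tau> K) / len K powr \<theta> * \<nu> k a)"
    proof (rule sum_mono)
      fix K assume "K \<in> idx k"
      then have "\<bar>a K\<bar> \<le> \<nu> k a / len K powr \<theta>"
        using coeff_le[of K k a] by (simp add: field_simps)
      then have "\<bar>a K\<bar> * \<nu> k (\<tau> K) \<le> \<nu> k a / len K powr \<theta> * \<nu> k (\<tau> K)"
        by (intro mult_right_mono nonneg)
      then show "\<nu> k (\<lambda>L. a K * \<tau> K L) \<le> \<nu> k (\<tau> K) / len K powr \<theta> * \<nu> k a"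
        by (simp add: homog mult.commute)
    qed
    finally show ?thesis by (simp add: C_def sum_distrib_right)
  qed
  have C: "0 \<le> C" unfolding C_def by (intro sum_nonneg) (simp add: nonneg)
  have unit: "\<nu> k (A b) \<le> \<Gamma>" if "\<nu> k b \<le> 1" for b
  proof -
    have "bdd_above ((\<lambda>f. normW k (T f)) ` {f \<in> haar_span k. normW k f \<le> 1})"
    proof (rule bdd_aboveI2)
      fix f assume "f \<in> {f \<in> haar_span k. normW k f \<le> 1}"
      then obtain b where b: "f = syn k b" "\<nu> k b \<le> 1" by (auto simp: haar_span_eq normW)
      show "normW k (T f) \<le> C"
        using le[of b] mult_left_mono[OF b(2) C] by (simp add: b(1) TA)
    qed
    then have "normW k (T (syn k b)) \<le> op_norm (haar_span k) (normW k) (normW k) T"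
      unfolding op_norm_def using that by (intro cSUP_upper) (auto simp: normW)
    then show ?thesis using \<Gamma> by (simp add: TA)
  qed
  have "\<nu> k (A a) \<le> \<Gamma> * \<nu> k a"
  proof (cases "\<nu> k a = 0")
    case True
    then show ?thesis using le[of a] by simp
  next
    case False
    then have pos: "0 < \<nu> k a" using nonneg[of k a] by simp
    define b where "b = (\<lambda>K. 1 / \<nu> k a * a K)"
    have "A b = (\<lambda>L. 1 / \<nu> k a * A a L)"
      by (simp add: A_def b_def fun_eq_iff sum_distrib_left mult.assoc)
    then have "\<nu> k (A b) = \<nu> k (A a) / \<nu> k a" using pos by (simp only: homog) simp
    moreover have "\<nu> k b \<le> 1" unfolding b_def homog using pos by simp
    ultimately have "\<nu> k (A a) / \<nu> k a \<le> \<Gamma>" using unit by metis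
    then show ?thesis using pos by (simp add: field_simps)
  qed
  then show ?thesis by (simp add: A_def \<tau>_def)
qed

text \<open>The zero function makes the set under the \<open>SUP\<close> nonempty and the operator
  norm nonnegative; nonnegativity serves to multiply the bounds of E and F.\<close>

lemma op_norm_syn:
  assumes normW: "\<And>k a. normW k (syn k a) = \<nu> k a"
    and E: "coeff_linear E" "\<And>a. \<nu> k (E a) \<le> c * \<nu> n a" and c: "0 \<le> c"
  shows "bounded_linear_between (haar_span n) (normW n) (haar_span k) (normW k) (\<lambda>f. syn k (E (cf n f)))"
    and "op_norm (haar_span n) (normW n) (normW k) (\<lambda>f. syn k (E (cf n f))) \<in> {0..c}"
proof -
  have le: "normW k (syn k (E (cf n f))) \<le> c * normW n f" if "f \<in> haar_span n" for f
    using E(2)[of "cf n f"] syn_cf[OF that] normW[of n "cf n f"] by (simp add: normW)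
  show "bounded_linear_between (haar_span n) (normW n) (haar_span k) (normW k) (\<lambda>f. syn k (E (cf n f)))"
    unfolding bounded_linear_between_def using linear_between_syn[OF E(1)] le by blast
  have le_c: "normW k (syn k (E (cf n f))) \<le> c" if "f \<in> haar_span n" "normW n f \<le> 1" for f
    using le[OF that(1)] mult_left_mono[OF that(2) c] by simp
  have z: "syn n (\<lambda>K. 0) \<in> {f \<in> haar_span n. normW n f \<le> 1}" by (simp add: normW zero)
  have "op_norm (haar_span n) (normW n) (normW k) (\<lambda>f. syn k (E (cf n f))) \<le> c"
    unfolding op_norm_def using z le_c by (intro cSUP_least) blast+
  moreover have "0 \<le> normW k (syn k (E (cf n (syn n (\<lambda>K. 0)))))" by (simp add: normW nonneg)
  moreover have "normW k (syn k (E (cf n (syn n (\<lambda>K. 0)))))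
      \<le> op_norm (haar_span n) (normW n) (normW k) (\<lambda>f. syn k (E (cf n f)))"
    unfolding op_norm_def using z le_c by (intro cSUP_upper bdd_aboveI2[where M = c]) auto
  ultimately show "op_norm (haar_span n) (normW n) (normW k) (\<lambda>f. syn k (E (cf n f))) \<in> {0..c}" by simp
qed

lemma factorization:
  assumes normW: "\<And>k a. normW k (syn k a) = \<nu> k a"
    and pos: "\<delta> > 0" "\<Gamma> > 0" "\<eta> > 0"
    and N: "int N = 19 * (int n + 2) + \<lfloor>4 * log 2 (\<Gamma> / \<delta>) + 4 * log 2 (1 + inverse \<eta>)\<rfloor>"
    and T: "linear_between (haar_span N) (haar_span N) T"
    and T_norm: "op_norm (haar_span N) (normW N) (normW N) T \<le> \<Gamma>"
    and diag: "\<forall>K\<in>dyadic_upto N. \<bar>pairing (T (haar K)) (haar K)\<bar> \<ge> \<delta> * measure lebesgue K"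
  shows "\<exists>E F.
      bounded_linear_between (haar_span n) (normW n) (haar_span N) (normW N) E \<and>
      bounded_linear_between (haar_span N) (normW N) (haar_span n) (normW n) F \<and>
      (\<forall>f\<in>haar_span n. F (T (E f)) = f) \<and>
      op_norm (haar_span n) (normW n) (normW N) E * op_norm (haar_span N) (normW N) (normW n) F
        \<le> (1 + \<eta>) / \<delta>"
proof -
  define \<tau> where "\<tau> = (\<lambda>K. cf N (T (haar (iv K))))"
  have bound: "\<nu> N (\<lambda>L. \<Sum>K\<in>idx N. a K * \<tau> K L) \<le> \<Gamma> * \<nu> N a" for a
    unfolding \<tau>_def by (rule op_norm_bound[OF normW T T_norm])
  have diag': "\<delta> \<le> \<bar>\<tau> K K\<bar>" if K: "K \<in> idx N" for K
  proof -
    have "haar (iv K) \<in> haar_span N"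
      using syn_in[of N "\<lambda>L. of_bool (L = K)"] syn_unit[OF K] by simp
    then have "syn N (\<tau> K) = T (haar (iv K))"
      using T unfolding \<tau>_def linear_between_def by (intro syn_cf) blast
    then have "pairing (T (haar (iv K))) (haar (iv K)) = pair N (\<tau> K) (\<lambda>L. of_bool (L = K))"
      using pairing_syn[of N "\<tau> K" "\<lambda>L. of_bool (L = K)"] by (simp only: syn_unit[OF K])
    also have "\<dots> = len K * \<tau> K K" using K by (simp add: pair_def)
    finally have eq: "pairing (T (haar (iv K))) (haar (iv K)) = len K * \<tau> K K" .
    have "iv K \<in> dyadic_upto N" using K iv_image by blast
    then have "\<delta> * len K \<le> \<bar>len K * \<tau> K K\<bar>" using diag eq by fastforce
    then have "len K * \<delta> \<le> len K * \<bar>\<tau> K K\<bar>" by (simp add: abs_mult mult.commute)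
    then show ?thesis by simp
  qed
  \<comment> \<open>The pair (0, 0) is the unit interval, available for every N.\<close>
  have "\<delta> \<le> \<Gamma>" using diagonal_le[OF bound, of "(0, 0)"] diag'[of "(0, 0)"] by simp
  then obtain m where m: "N = m + n"
    and \<kappa>: "(\<Gamma> / \<delta>)\<^sup>2 * 2 ^ (9 * n + 3) * sqrt (1 / 2 ^ m) \<le> (\<eta> / (1 + \<eta>))\<^sup>2"
    using level_choice[OF pos(1) _ pos(3) N] by blast
  have \<kappa>': "0 \<le> \<eta> / (1 + \<eta>)" "\<eta> / (1 + \<eta>) < 1" using pos by auto
  \<comment> \<open>\<kappa> = \<eta> / (1 + \<eta>) makes the Neumann bound of E exactly 1 +
    \<eta>; F contributes 1 / \<delta>.\<close>
  have "1 / (1 - \<eta> / (1 + \<eta>)) = 1 + \<eta>" using pos by (simp add: field_simps)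
  then have div: "x / (1 - \<eta> / (1 + \<eta>)) = (1 + \<eta>) * x" for x
    by (metis mult.commute mult.right_neutral times_divide_eq_right)
  from factor[OF less_imp_le[OF pos(2)] bound[unfolded m] pos(1) diag'[unfolded m] \<kappa>' \<kappa>]
  obtain E F where E: "coeff_linear E" and F: "coeff_linear F"
    and FE: "\<And>a J. J \<in> idx n \<Longrightarrow> F (\<lambda>L. \<Sum>K\<in>idx N. E a K * \<tau> K L) J = a J"
    and E_le: "\<And>a. \<nu> N (E a) \<le> (1 + \<eta>) * \<nu> n a"
    and F_le: "\<And>b. \<nu> n (F b) \<le> 1 / \<delta> * \<nu> N b"
    unfolding div m by auto
  define E' where "E' = (\<lambda>f. syn N (E (cf n f)))"
  define F' where "F' = (\<lambda>f. syn n (F (cf N f)))"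
  have "0 \<le> 1 + \<eta>" "0 \<le> 1 / \<delta>" using pos by auto
  note E' = op_norm_syn[of normW, OF normW E E_le this(1), folded E'_def]
    and F' = op_norm_syn[of normW, OF normW F F_le this(2), folded F'_def]
  have id: "F' (T (E' f)) = f" if f: "f \<in> haar_span n" for f
  proof -
    have "cf N (T (E' f)) = (\<lambda>L. \<Sum>K\<in>idx N. E (cf n f) K * \<tau> K L)"
      unfolding E'_def linear_between_expand[OF T] cf_syn \<tau>_def by (rule ext) (simp add: cf_def)
    then have "F' (T (E' f)) = syn n (F (\<lambda>L. \<Sum>K\<in>idx N. E (cf n f) K * \<tau> K L))"
      by (simp add: F'_def)
    also have "\<dots> = syn n (cf n f)" by (intro syn_cong FE)
    also have "\<dots> = f" by (rule syn_cf[OF f])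
    finally show ?thesis .
  qed
  have "op_norm (haar_span n) (normW n) (normW N) E' * op_norm (haar_span N) (normW N) (normW n) F'
      \<le> (1 + \<eta>) * (1 / \<delta>)"
    using E'(2) F'(2) pos by (intro mult_mono) auto
  then have "op_norm (haar_span n) (normW n) (normW N) E' * op_norm (haar_span N) (normW N) (normW n) F'
      \<le> (1 + \<eta>) / \<delta>" by simp
  with E'(1) F'(1) id show ?thesis by blast
qed

end

theorem theorem3p1:
  fixes p \<delta> \<Gamma> \<eta> :: real and n N :: nat
    and normW :: "nat \<Rightarrow> (real \<Rightarrow> real) \<Rightarrow> real"
    and T :: "(real \<Rightarrow> real) \<Rightarrow> (real \<Rightarrow> real)"
  assumes "1 \<le> p"
    and "normW \<in> {\<lambda>k. hardy_norm p, \<lambda>k. hardy_dual_norm p k, \<lambda>k. sl_norm}"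
    and "1 \<le> n"
    and "\<delta> > 0" and "\<Gamma> > 0" and "\<eta> > 0"
    and "int N = 19 * (int n + 2) + \<lfloor>4 * log 2 (\<Gamma> / \<delta>) + 4 * log 2 (1 + inverse \<eta>)\<rfloor>"
    and "1 \<le> N"
    and "linear_between (haar_span N) (haar_span N) T"
    and "op_norm (haar_span N) (normW N) (normW N) T \<le> \<Gamma>"
    and "\<forall>K\<in>dyadic_upto N. \<bar>pairing (T (haar K)) (haar K)\<bar> \<ge> \<delta> * measure lebesgue K"
  shows "\<exists>E F.
      bounded_linear_between (haar_span n) (normW n) (haar_span N) (normW N) E \<and>
      bounded_linear_between (haar_span N) (normW N) (haar_span n) (normW n) F \<and>
      (\<forall>f\<in>haar_span n. F (T (E f)) = f) \<and>
      op_norm (haar_span n) (normW n) (normW N) E * op_norm (haar_span N) (normW N) (normW n) F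
        \<le> (1 + \<eta>) / \<delta>"
proof -
  \<comment> \<open>The exponents are 1/p for the Hardy norm, 1 - 1/p for its dual and 0 for the SL
    norm.\<close>
  have "\<exists>\<nu> \<theta>. haar_norm \<nu> \<theta> \<and> (\<forall>k a. normW k (syn k a) = \<nu> k a)"
  proof -
    have hardy: "haar_norm (\<lambda>k a. lp_norm p k (sqf k a)) (1 / p)"
      by (rule mean_norm.haar_norm[OF mean_norm_lp[OF assms(1)]])
    consider "normW = (\<lambda>k. hardy_norm p)" | "normW = (\<lambda>k. hardy_dual_norm p k)" | "normW = (\<lambda>k. sl_norm)"
      using assms(2) by blast
    then show ?thesis
    proof cases
      case 1
      then show ?thesis using hardy hardy_norm_syn[OF assms(1)] by blast
    next
      case 2
      then show ?thesis
        using haar_norm.dual_haar_norm[OF hardy] hardy_dual_norm_syn[OF assms(1)] by blast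
    next
      case 3
      then show ?thesis using mean_norm.haar_norm[OF mean_norm_max] sl_norm_syn by blast
    qed
  qed
  then show ?thesis using haar_norm.factorization assms(4-7,9-11) by blast
qed

end
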